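(* Let $(X_n)_{n\ge 1}$ be a determining sequence of real random variables on a probability space $(\Omega,\mathcal F,P)$, with limit random measure $\tilde\mu$. Let $T=(f_1,f_2,\ldots,S,\{G_\mu,\ \mu\in S\})$ be a regular weak limit theorem of i.i.d. random variables and assume that $P(\tilde\mu\in S)=1$. Then there exists a subsequence $(Y_k)_{k\ge1}=(X_{n_k})_{k\ge 1}$ (with $n_1<n_2<\cdots$) such that for every permutation $(Y'_k)_{k\ge1}$ of $(Y_k)_{k\ge1}$ (i.e. $Y'_k=Y_{\pi(k)}$ for a bijection $\pi$ of the positive integers) we have $$f_k(Y'_1,Y'_2,\ldots,\tilde\mu)\overset{d}{\longrightarrow}\int G_{\tilde\mu}\,dP\qquad\text{as } k\to\infty .$$
   Context: Notation. $\mathcal M$ is the set of all (Borel) probability measures on $\mathbb R$, equipped with the Prohorov metric $$\varrho(\nu,\lambda)=\inf\{\varepsilon>0:\ \nu(A)\le\lambda(A^\varepsilon)+\varepsilon \text{ and } \lambda(A)\le\nu(A^\varepsilon)+\varepsilon \text{ for all Borel sets } A\subset\mathbb R\},$$ where $A^\varepsilon=\{x\in\mathbb R:\ |x-y|<\varepsilon\text{ for some }y\in A\}$, and with the corresponding Borel $\sigma$-field. A random measure is a measurable map from a probability space to $\mathcal M$. The symbol $\overset{d}{\longrightarrow}$ denotes convergence in distribution. Determining sequences. A sequence $(X_n)$ of random variables on $(\Omega,\mathcal F,P)$ is called determining if for every $A\in\mathcal F$ with $P(A)>0$ there exists a (probability) distribution function $F_A$ such that $\lim_{n\to\infty}P(X_n<t\mid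 A)=F_A(t)$ for all continuity points $t$ of $F_A$. For any determining sequence $(X_n)$ there exists a random measure $\tilde\mu:\Omega\to\mathcal M$ (defined on the same probability space) such that for every $A\in\mathcal F$ with $P(A)>0$ and every continuity point $t$ of $F_A$, $F_A(t)=\mathbb E_A(\tilde\mu(-\infty,t))$, where $\mathbb E_A$ denotes conditional expectation given the event $A$. This $\tilde\mu$ is called the limit random measure of $(X_n)$. Regular weak limit theorems. A regular weak limit theorem of i.i.d. random variables is a system $T=(f_1,f_2,\ldots,S,\{G_\mu,\ \mu\in S\})$ where: (a) $S$ is a Borel subset of $\mathcal M$; (b) for each $k\ge1$, $f_k=f_k(x_1,x_2,\ldots,\mu)$ is a continuous real-valued function on $\mathbb R^\infty\times\mathcal M$, and there exist two sequences $p_k\le q_k$ of positive integers tending to $+\infty$, a sequence $\omega_k\to+\infty$ of positive reals, a number $0<\alpha\le1$, and a metric $\varrho^*$ on $S$ generating the same topology on $S$ as the Prohorov metric $\varrho$, such that (i) $f_k(x_1,x_2,\ldots,\mu)$ depends only on $x_{p_k},\ldots,x_{q_k},\mu$ (and so is also written $f_k(x_{p_k},\ldots,x_{q_k},\mu)$); (ii) for all $k\ge 1$, all real $x_i,x'_i$ and all $\mu,\mu'\in S$, $$|f_k(x_{p_k},\ldots,x_{q_k},\mu)-f_k(x'_{p_k},\ldots,x'_{q_k},\mu')|\le\frac1{\omega_k}\sum_{i=p_k}^{q_k}|x_i-x'_i|^\alpha+\varrho^*(\mu,\mu');$$ (c) for each $\mu\in S$, $G_\mu$ is a probability distribution on $\mathbb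 R$ such that the map $\mu\mapsto G_\mu$ from $S$ to $\mathcal M$ is measurable (with respect to the Borel $\sigma$-fields); (d) if $\mu\in S$ and $\xi_1,\xi_2,\ldots$ are independent random variables with common distribution $\mu$, then $f_k(\xi_1,\xi_2,\ldots,\mu)\overset{d}{\longrightarrow}G_\mu$ as $k\to\infty$. Finally, $\int G_{\tilde\mu}\,dP$ denotes the mixture probability distribution on $\mathbb R$ given by $B\mapsto\int_\Omega G_{\tilde\mu(\omega)}(B)\,dP(\omega)$ for Borel sets $B\subset\mathbb R$ (well defined since $\tilde\mu\in S$ almost surely). *)

theory Defs
  imports "HOL-Probability.Probability"
begin

section \<open>The space of Borel probability measures on the line\<close>

typedef borel_prob = "{\<nu> :: real measure. real_distribution \<nu>}"
  morphisms meas Abs_borel_prob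
proof
  show "return borel 0 \<in> {\<nu> :: real measure. real_distribution \<nu>}"
    by (simp add: real_distribution_def real_distribution_axioms_def prob_space_return)
qed

lemma real_distribution_meas: "real_distribution (meas \<nu>)"
  using meas[of \<nu>] by simp

lemma sets_meas [simp, measurable_cong]: "sets (meas \<nu>) = sets borel"
  by (rule real_distribution.events_eq_borel[OF real_distribution_meas])

lemma prob_space_meas: "prob_space (meas \<nu>)"
  using real_distribution_meas[of \<nu>] by (simp add: real_distribution_def)

definition open_nbhd :: "real set \<Rightarrow> real \<Rightarrow> real set" where
  "open_nbhd A \<epsilon> = {x. \<exists>y\<in>A. \<bar>x - y\<bar> < \<epsilon>}"

definition prohorov_admissible :: "borel_prob \<Rightarrow> borel_prob \<Rightarrow> real set" where
  "prohorov_admissible \<nu> \<kappa> = {\<epsilon>. \<epsilon> > 0 \<and> (\<forall>A\<in>sets borel.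
     measure (meas \<nu>) A \<le> measure (meas \<kappa>) (open_nbhd A \<epsilon>) + \<epsilon> \<and>
     measure (meas \<kappa>) A \<le> measure (meas \<nu>) (open_nbhd A \<epsilon>) + \<epsilon>)}"

lemma open_open_nbhd [simp]: "open (open_nbhd A \<epsilon>)"
proof -
  have "open_nbhd A \<epsilon> = (\<Union>y\<in>A. ball y \<epsilon>)"
    by (auto simp: open_nbhd_def dist_real_def abs_minus_commute)
  then show ?thesis by (simp add: open_UN)
qed

lemma sets_open_nbhd [simp, measurable]: "open_nbhd A \<epsilon> \<in> sets borel"
  by (simp add: borel_open)

lemma prohorov_admissible_commute: "prohorov_admissible \<nu> \<kappa> = prohorov_admissible \<kappa> \<nu>"
  by (auto simp: prohorov_admissible_def)

lemma one_in_prohorov_admissible: "1 \<in> prohorov_admissible \<nu> \<kappa>"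
  unfolding prohorov_admissible_def
  using prob_space.prob_le_1[OF prob_space_meas]
  by (auto intro: order_trans add_increasing)

lemma bdd_below_prohorov_admissible: "bdd_below (prohorov_admissible \<nu> \<kappa>)"
  by (auto simp: prohorov_admissible_def intro!: bdd_belowI[of _ 0])

lemma prohorov_admissible_add:
  assumes "a \<in> prohorov_admissible x z" "b \<in> prohorov_admissible z y"
  shows "a + b \<in> prohorov_admissible x y"
proof -
  have sub: "open_nbhd (open_nbhd A s) t \<subseteq> open_nbhd A (a + b)"
    if "s + t = a + b" for A s t
    unfolding open_nbhd_def using that by clarsimp (smt (verit))
  have m: "measure (meas \<nu>) (open_nbhd (open_nbhd A s) t) \<le> measure (meas \<nu>) (open_nbhd A (a + b))"
    if "s + t = a + b" for A s t \<nu>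
    using finite_measure.finite_measure_mono[OF prob_space.finite_measure[OF prob_space_meas]
        sub[OF that]] by simp
  have ab: "a > 0" "b > 0" using assms by (auto simp: prohorov_admissible_def)
  have "measure (meas x) A \<le> measure (meas y) (open_nbhd A (a + b)) + (a + b) \<and>
        measure (meas y) A \<le> measure (meas x) (open_nbhd A (a + b)) + (a + b)"
    if A: "A \<in> sets borel" for A
  proof
    have "measure (meas x) A \<le> measure (meas z) (open_nbhd A a) + a"
      using assms(1) A by (auto simp: prohorov_admissible_def)
    moreover have "measure (meas z) (open_nbhd A a) \<le>
        measure (meas y) (open_nbhd (open_nbhd A a) b) + b"
      using assms(2) by (auto simp: prohorov_admissible_def)
    ultimately show "measure (meas x) A \<le> measure (meas y) (open_nbhd A (a + b)) + (a + b)"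
      using m[of a b y A] by linarith
    have "measure (meas y) A \<le> measure (meas z) (open_nbhd A b) + b"
      using assms(2) A by (auto simp: prohorov_admissible_def)
    moreover have "measure (meas z) (open_nbhd A b) \<le>
        measure (meas x) (open_nbhd (open_nbhd A b) a) + a"
      using assms(1) by (auto simp: prohorov_admissible_def)
    ultimately show "measure (meas y) A \<le> measure (meas x) (open_nbhd A (a + b)) + (a + b)"
      using m[of b a x A] by linarith
  qed
  with ab show ?thesis by (auto simp: prohorov_admissible_def)
qed

lemma prohorov_admissible_self: "e > 0 \<Longrightarrow> e \<in> prohorov_admissible \<nu> \<nu>"
proof -
  assume e: "e > 0"
  have "measure (meas \<nu>) A \<le> measure (meas \<nu>) (open_nbhd A e)" for A
    using finite_measure.finite_measure_mono[OF prob_space.finite_measure[OF prob_space_meas],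
        of A "open_nbhd A e" \<nu>] e
    by (force simp: open_nbhd_def[of A e] intro: sets_open_nbhd[unfolded open_nbhd_def])
  with e show ?thesis by (auto simp: prohorov_admissible_def intro: add_increasing2)
qed

lemma measure_closed_le_if_Inf_prohorov_eq_0:
  assumes "Inf (prohorov_admissible \<nu> \<kappa>) = 0" "closed A"
  shows "measure (meas \<nu>) A \<le> measure (meas \<kappa>) A"
proof -
  have "\<exists>e\<in>prohorov_admissible \<nu> \<kappa>. e < inverse (real (Suc n))" for n
    using assms(1) one_in_prohorov_admissible[of \<nu> \<kappa>]
    by (intro cInf_lessD) auto
  then obtain e where e: "\<And>n. e n \<in> prohorov_admissible \<nu> \<kappa>" "\<And>n. e n < inverse (real (Suc n))"
    by metis
  let ?U = "\<lambda>n. open_nbhd A (inverse (real (Suc n)))"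
  have le: "measure (meas \<nu>) A \<le> measure (meas \<kappa>) (?U n) + inverse (real (Suc n))" for n
  proof -
    have "measure (meas \<nu>) A \<le> measure (meas \<kappa>) (open_nbhd A (e n)) + e n"
      using e(1)[of n] assms(2) by (auto simp: prohorov_admissible_def)
    moreover have "measure (meas \<kappa>) (open_nbhd A (e n)) \<le> measure (meas \<kappa>) (?U n)"
      using e(2)[of n]
      by (intro finite_measure.finite_measure_mono[OF prob_space.finite_measure[OF prob_space_meas]])
        (force simp: open_nbhd_def intro: less_trans, simp)
    ultimately show ?thesis using e(2)[of n] by linarith
  qed
  have "(\<Inter>n. ?U n) = A"
  proof (intro equalityI subsetI)
    fix x assume "x \<in> (\<Inter>n. ?U n)"
    then have *: "\<exists>y\<in>A. \<bar>x - y\<bar> < inverse (real (Suc n))" for n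
      by (auto simp: open_nbhd_def)
    have "x \<in> closure A"
      unfolding closure_approachable
    proof (intro allI impI)
      fix r :: real assume "r > 0"
      then obtain n where "inverse (real (Suc n)) < r" using reals_Archimedean by blast
      with *[of n] show "\<exists>y\<in>A. dist y x < r"
        by (force simp: dist_real_def abs_minus_commute)
    qed
    then show "x \<in> A" using assms(2) by simp
  qed (force simp: open_nbhd_def)
  moreover have "decseq ?U"
  proof (rule decseq_SucI)
    fix n
    have "inverse (real (Suc (Suc n))) \<le> inverse (real (Suc n))" by (simp add: field_simps)
    then show "?U (Suc n) \<subseteq> ?U n"
      unfolding open_nbhd_def by (blast intro: less_le_trans)
  qed
  moreover have "range ?U \<subseteq> sets (meas \<kappa>)" by auto
  ultimately have "(\<lambda>n. measure (meas \<kappa>) (?U n)) \<longlonglongrightarrow> measure (meas \<kappa>) A"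
    using finite_measure.finite_Lim_measure_decseq[OF prob_space.finite_measure[OF prob_space_meas],
        of ?U \<kappa>] by metis
  from tendsto_add[OF this LIMSEQ_inverse_real_of_nat] le show ?thesis
    by (intro LIMSEQ_le_const) auto
qed

text \<open>The metric-space structure of \<^typ>\<open>borel_prob\<close> is the Prohorov metric; hence
  \<open>open\<close>, \<open>continuous_on\<close> and \<open>borel\<close> on this type refer to the Prohorov topology.\<close>

instantiation borel_prob :: metric_space
begin

definition dist_borel_prob :: "borel_prob \<Rightarrow> borel_prob \<Rightarrow> real" where
  "dist \<nu> \<kappa> = Inf (prohorov_admissible \<nu> \<kappa>)"

definition uniformity_borel_prob :: "(borel_prob \<times> borel_prob) filter" where
  "uniformity_borel_prob = (INF e\<in>{0 <..}. principal {(x, y). dist x y < e})"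

definition open_borel_prob :: "borel_prob set \<Rightarrow> bool" where
  "open_borel_prob U = (\<forall>x\<in>U. eventually (\<lambda>(x', y). x' = x \<longrightarrow> y \<in> U) uniformity)"

instance
proof
  fix x y z :: borel_prob and U :: "borel_prob set"
  show "uniformity = (INF e\<in>{0 <..}. principal {(x :: borel_prob, y). dist x y < e})"
    by (rule uniformity_borel_prob_def)
  show "open U = (\<forall>x\<in>U. eventually (\<lambda>(x', y). x' = x \<longrightarrow> y \<in> U) uniformity)"
    by (rule open_borel_prob_def)
  show "dist x y = 0 \<longleftrightarrow> x = y"
  proof
    assume 0: "dist x y = 0"
    have eq: "measure (meas x) A = measure (meas y) A" if "closed A" for A
      using measure_closed_le_if_Inf_prohorov_eq_0[of x y A]
        measure_closed_le_if_Inf_prohorov_eq_0[of y x A] 0 that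
      by (auto simp: dist_borel_prob_def prohorov_admissible_commute[of y x])
    have "cdf (meas x) = cdf (meas y)"
      by (auto simp: cdf_def eq)
    then have "meas x = meas y"
      by (intro cdf_unique real_distribution_meas)
    then show "x = y" by (simp add: meas_inject)
  next
    assume "x = y"
    have "Inf (prohorov_admissible x x) \<le> e" if "e > 0" for e
      using prohorov_admissible_self[OF that] bdd_below_prohorov_admissible by (rule cInf_lower)
    then have "Inf (prohorov_admissible x x) \<le> 0"
      by (metis dense not_le order.strict_iff_order)
    moreover have "0 \<le> Inf (prohorov_admissible x x)"
    proof (rule cInf_greatest)
      show "prohorov_admissible x x \<noteq> {}" using one_in_prohorov_admissible[of x x] by blast
    qed (simp add: prohorov_admissible_def)
    ultimately show "dist x y = 0" using \<open>x = y\<close> by (simp add: dist_borel_prob_def)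
  qed
  show "dist x y \<le> dist x z + dist y z"
  proof (rule field_le_epsilon)
    fix e :: real assume e: "0 < e"
    obtain a where a: "a \<in> prohorov_admissible x z" "a < dist x z + e / 2"
      using cInf_lessD[of "prohorov_admissible x z" "dist x z + e / 2"]
        one_in_prohorov_admissible[of x z] e by (auto simp: dist_borel_prob_def)
    obtain b where b: "b \<in> prohorov_admissible y z" "b < dist y z + e / 2"
      using cInf_lessD[of "prohorov_admissible y z" "dist y z + e / 2"]
        one_in_prohorov_admissible[of y z] e by (auto simp: dist_borel_prob_def)
    have "a + b \<in> prohorov_admissible x y"
      using prohorov_admissible_add a(1) b(1) prohorov_admissible_commute by blast
    then have "dist x y \<le> a + b"
      unfolding dist_borel_prob_def by (rule cInf_lower[OF _ bdd_below_prohorov_admissible])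
    with a b show "dist x y \<le> dist x z + dist y z + e" by linarith
  qed
qed

end

section \<open>Determining sequences\<close>

text \<open>Distribution functions follow the left-continuous convention \<open>F t = \<nu>(-\<infinity>, t)\<close>.\<close>

definition distribution_function :: "(real \<Rightarrow> real) \<Rightarrow> bool" where
  "distribution_function F \<longleftrightarrow> (\<exists>\<nu>. \<forall>t. F t = measure (meas \<nu>) {..<t})"

definition conditional_limit_df ::
  "'a measure \<Rightarrow> (nat \<Rightarrow> 'a \<Rightarrow> real) \<Rightarrow> 'a set \<Rightarrow> (real \<Rightarrow> real) \<Rightarrow> bool" where
  "conditional_limit_df M X A F \<longleftrightarrow> distribution_function F \<and>
     (\<forall>t. isCont F t \<longrightarrow> (\<lambda>n. \<P>(\<omega> in M. X n \<omega> < t \<bar> \<omega> \<in> A)) \<longlonglongrightarrow> F t)"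

definition determining :: "'a measure \<Rightarrow> (nat \<Rightarrow> 'a \<Rightarrow> real) \<Rightarrow> bool" where
  "determining M X \<longleftrightarrow> (\<forall>n. X n \<in> borel_measurable M) \<and>
     (\<forall>A\<in>sets M. measure M A > 0 \<longrightarrow> (\<exists>F. conditional_limit_df M X A F))"

text \<open>The function \<open>F\<^sub>A\<close> of a determining sequence is unique, so quantifying over all \<open>F\<close> below
  just names it. \<^term>\<open>uniform_measure M A\<close> is the conditional probability given the event \<open>A\<close>.\<close>

definition limit_random_measure ::
  "'a measure \<Rightarrow> (nat \<Rightarrow> 'a \<Rightarrow> real) \<Rightarrow> ('a \<Rightarrow> borel_prob) \<Rightarrow> bool" where
  "limit_random_measure M X \<mu> \<longleftrightarrow> \<mu> \<in> borel_measurable M \<and>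
     (\<forall>A\<in>sets M. measure M A > 0 \<longrightarrow>
       (\<forall>F. conditional_limit_df M X A F \<longrightarrow>
         (\<forall>t. isCont F t \<longrightarrow>
           F t = (\<integral>\<omega>. measure (meas (\<mu> \<omega>)) {..<t} \<partial>uniform_measure M A))))"

section \<open>Regular weak limit theorems\<close>

text \<open>All sequences are indexed from \<open>0\<close>: \<open>f k\<close>, \<open>x i\<close>, \<open>p k\<close>, \<open>q k\<close> stand for
  \<open>f\<^bsub>k+1\<^esub>\<close>, \<open>x\<^bsub>i+1\<^esub>\<close>, \<open>p\<^bsub>k+1\<^esub> - 1\<close>, \<open>q\<^bsub>k+1\<^esub> - 1\<close>. The type \<^typ>\<open>nat \<Rightarrow> real\<close> carries the
  product topology. \<open>G\<close> is total, but only its values on \<open>S\<close> are constrained.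

  In the last clause the sample space is taken to have type \<^typ>\<open>nat \<Rightarrow> real\<close>, since a definition
  cannot quantify over types; this is no restriction, because every i.i.d. sequence has the joint
  law of the coordinate sequence on that space.\<close>

definition regular_weak_limit_theorem ::
  "(nat \<Rightarrow> (nat \<Rightarrow> real) \<Rightarrow> borel_prob \<Rightarrow> real) \<Rightarrow> borel_prob set \<Rightarrow> (borel_prob \<Rightarrow> borel_prob) \<Rightarrow> bool"
where
  "regular_weak_limit_theorem f S G \<longleftrightarrow>
     S \<in> sets borel \<and>
     (\<forall>k. continuous_on UNIV (\<lambda>(x, \<mu>). f k x \<mu>)) \<and>
     (\<exists>(p :: nat \<Rightarrow> nat) (q :: nat \<Rightarrow> nat) (\<omega> :: nat \<Rightarrow> real) (\<alpha> :: real) \<rho>.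
        (\<forall>k. p k \<le> q k) \<and>
        filterlim p at_top sequentially \<and> filterlim q at_top sequentially \<and>
        (\<forall>k. \<omega> k > 0) \<and> filterlim \<omega> at_top sequentially \<and>
        0 < \<alpha> \<and> \<alpha> \<le> 1 \<and>
        Metric_space S \<rho> \<and> Metric_space.mtopology S \<rho> = top_of_set S \<and>
        (\<forall>k x x' \<mu>. (\<forall>i\<in>{p k..q k}. x i = x' i) \<longrightarrow> f k x \<mu> = f k x' \<mu>) \<and>
        (\<forall>k x x'. \<forall>\<mu>\<in>S. \<forall>\<mu>'\<in>S.
           \<bar>f k x \<mu> - f k x' \<mu>'\<bar> \<le> 1 / \<omega> k * (\<Sum>i=p k..q k. \<bar>x i - x' i\<bar> powr \<alpha>) + \<rho> \<mu> \<mu>')) \<and>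
     G \<in> borel_measurable (restrict_space borel S) \<and>
     (\<forall>\<mu>\<in>S. \<forall>(N :: (nat \<Rightarrow> real) measure) \<xi>.
        prob_space N \<longrightarrow>
        prob_space.indep_vars N (\<lambda>_. borel) \<xi> UNIV \<longrightarrow>
        (\<forall>i. distr N borel (\<xi> i) = meas \<mu>) \<longrightarrow>
        weak_conv_m (\<lambda>k. distr N borel (\<lambda>s. f k (\<lambda>i. \<xi> i s) \<mu>)) (meas (G \<mu>)))"

definition mixture :: "'a measure \<Rightarrow> ('a \<Rightarrow> borel_prob) \<Rightarrow> real measure" where
  "mixture M \<nu> = measure_of UNIV (sets borel) (\<lambda>B. \<integral>\<^sup>+\<omega>. emeasure (meas (\<nu> \<omega>)) B \<partial>M)"

end

theory Submission
  imports Defs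
begin

text \<open>A determining sequence converges stably: \<open>E[Z g(X\<^sub>n)] \<longrightarrow> E[Z \<integral>g d\<mu>]\<close> for bounded \<open>Z\<close>
  and bounded continuous \<open>g\<close>. So a term \<open>X\<^sub>n\<close> with \<open>n\<close> far out looks, to any fixed observer
  of the sample point, like a fresh draw from the random law \<open>\<mu>(\<omega>)\<close>. The proof is a swapping argument
  of Lindeberg type built on this: in \<open>E h(f\<^sub>k(Y'\<^sub>1, Y'\<^sub>2, \<dots>, \<mu>))\<close> the finitely many variables on which
  \<open>f\<^sub>k\<close> depends are exchanged, one at a time, for independent draws from \<open>\<mu>(\<omega>)\<close>. Once all are
  exchanged, the expectation is \<open>E[\<integral>h(f\<^sub>k(u, \<mu>)) d\<mu>\<^sup>\<infinity>(u)]\<close>, which tends to \<open>E[\<integral>h dG\<^sub>\<mu>]\<close> by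
  the limit theorem for i.i.d. variables and dominated convergence.

  The order of the swaps matters: the variable with the largest index \<open>j\<close> in the subsequence goes first.
  When \<open>Y\<^sub>j\<close> is swapped, later variables have already been integrated out, and the rest of the
  integrand depends on \<open>\<omega>\<close> only through \<open>\<mu>\<close> and earlier terms of the subsequence. The error therefore
  tends to \<open>0\<close> as the index \<open>n\<^sub>j\<close> tends to infinity, for each fixed integrand
  (\<open>swap_tendsto\<close>, from \<open>stable_Caratheodory\<close>). If only finitely many integrands have to be served at
  stage \<open>j\<close>, then \<open>n\<^sub>j\<close> can be chosen to make all their errors less than \<open>2\<^sup>-\<^sup>j\<close>.

  Infinitely many \<open>k\<close> and permutations involve \<open>Y\<^sub>j\<close>, however. A permutation enters a
  swap at stage \<open>j\<close> only through the positions of the indices below \<open>j\<close> and those of the indices above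
  \<open>j\<close>, which leaves finitely many possibilities for each \<open>k\<close>. To leave finitely many \<open>k\<close>, the factor
  \<open>1/\<omega>\<^sub>k\<close> in the Hoelder condition is used: a single swap, of any variable whatever, costs at most
  \<open>e\<^sub>k\<close> with \<open>e\<^sub>k \<longrightarrow> 0\<close> (\<open>mean_cost_sup\<close>). Choose \<open>N\<^sub>k \<longrightarrow> \<infinity>\<close> so slowly that \<open>N\<^sub>k e\<^sub>k \<longrightarrow> 0\<close>. For
  \<open>f\<^sub>k\<close> the indices below \<open>N\<^sub>k\<close> are swapped at the crude cost \<open>e\<^sub>k\<close> each, and stage \<open>j\<close> is responsible
  only for the finitely many \<open>k\<close> with \<open>N\<^sub>k \<le> j\<close>. The total error is at most
  \<open>N\<^sub>k e\<^sub>k + \<Sum>\<^sub>j\<^sub>\<ge>\<^sub>N 2\<^sup>-\<^sup>j\<close> with \<open>N = N\<^sub>k\<close>, whatever the permutation (\<open>swapping_subsequence\<close>).\<close>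

section \<open>Measurability on the space of laws\<close>

lemma open_nbhd_mono: "a \<le> b \<Longrightarrow> open_nbhd A a \<subseteq> open_nbhd A b"
  by (force simp: open_nbhd_def)

lemma measure_meas_mono:
  "A \<subseteq> B \<Longrightarrow> B \<in> sets borel \<Longrightarrow> measure (meas \<nu>) A \<le> measure (meas \<nu>) B"
  by (rule finite_measure.finite_measure_mono[OF prob_space.finite_measure[OF prob_space_meas]]) auto

lemma INT_open_nbhd_closed:
  assumes "closed A"
  shows "(\<Inter>n. open_nbhd A (inverse (real (Suc n)))) = A"
proof (intro equalityI subsetI)
  fix x assume "x \<in> (\<Inter>n. open_nbhd A (inverse (real (Suc n))))"
  then have *: "\<exists>y\<in>A. dist y x < inverse (real (Suc n))" for n
    by (auto simp: open_nbhd_def dist_real_def abs_minus_commute)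
  have "x \<in> closure A"
    unfolding closure_approachable
    using * by (metis less_trans reals_Archimedean)
  then show "x \<in> A" using assms by simp
qed (force simp: open_nbhd_def)

lemma measure_open_nbhd_tendsto:
  assumes "closed A"
  shows "(\<lambda>n. measure (meas \<nu>) (open_nbhd A (inverse (real (Suc n))))) \<longlonglongrightarrow> measure (meas \<nu>) A"
proof -
  let ?U = "\<lambda>n. open_nbhd A (inverse (real (Suc n)))"
  have "decseq ?U"
    by (intro decseq_SucI open_nbhd_mono) (simp add: field_simps)
  then have "(\<lambda>n. measure (meas \<nu>) (?U n)) \<longlonglongrightarrow> measure (meas \<nu>) (\<Inter>n. ?U n)"
    by (intro finite_measure.finite_Lim_measure_decseq
        prob_space.finite_measure prob_space_meas) auto
  then show ?thesis by (simp only: INT_open_nbhd_closed[OF assms])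
qed

text \<open>Upper semicontinuity of \<open>\<nu> \<mapsto> \<nu>(A)\<close> for closed \<open>A\<close>: a law close to \<open>\<nu>\<close> gives \<open>A\<close> hardly more
  mass than \<open>\<nu>\<close> gives a small neighbourhood of \<open>A\<close>. It makes the Prohorov Borel sets fine enough for
  evaluations to be measurable.\<close>

lemma open_measure_closed_less:
  assumes "closed A"
  shows "open {\<nu>. measure (meas \<nu>) A < c}"
  unfolding open_dist
proof (intro ballI)
  fix \<nu> assume "\<nu> \<in> {\<nu>. measure (meas \<nu>) A < c}"
  then have *: "measure (meas \<nu>) A < c" by simp
  have "(\<lambda>n. measure (meas \<nu>) (open_nbhd A (inverse (real (Suc n)))) + inverse (real (Suc n)))
      \<longlonglongrightarrow> measure (meas \<nu>) A + 0"
    by (intro tendsto_add measure_open_nbhd_tendsto assms LIMSEQ_inverse_real_of_nat)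
  then have "\<forall>\<^sub>F n in sequentially.
      measure (meas \<nu>) (open_nbhd A (inverse (real (Suc n)))) + inverse (real (Suc n)) < c"
    using * by (intro order_tendstoD(2)) auto
  then obtain n where
    n: "measure (meas \<nu>) (open_nbhd A (inverse (real (Suc n)))) + inverse (real (Suc n)) < c"
    by (auto simp: eventually_sequentially)
  define e where "e = inverse (real (Suc n))"
  show "\<exists>e>0. \<forall>\<kappa>. dist \<kappa> \<nu> < e \<longrightarrow> \<kappa> \<in> {\<nu>. measure (meas \<nu>) A < c}"
  proof (intro exI conjI allI impI)
    show "0 < e" by (simp add: e_def)
    fix \<kappa> assume "dist \<kappa> \<nu> < e"
    then obtain d where d: "d \<in> prohorov_admissible \<kappa> \<nu>" "d < e"
      using cInf_lessD[of "prohorov_admissible \<kappa> \<nu>" e] one_in_prohorov_admissible[of \<kappa> \<nu>]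
      by (auto simp: dist_borel_prob_def)
    have "measure (meas \<kappa>) A \<le> measure (meas \<nu>) (open_nbhd A d) + d"
      using d(1) assms by (auto simp: prohorov_admissible_def)
    also have "\<dots> \<le> measure (meas \<nu>) (open_nbhd A e) + e"
      using d(2) measure_meas_mono[OF open_nbhd_mono[of d e A], of \<nu>] by simp
    finally show "\<kappa> \<in> {\<nu>. measure (meas \<nu>) A < c}" using n by (simp add: e_def)
  qed
qed

lemma measurable_meas: "meas \<in> borel \<rightarrow>\<^sub>M prob_algebra borel"
proof (rule measurable_prob_algebra_generated[where \<Omega>=UNIV and G="Collect closed"])
  show "sets borel = sigma_sets (UNIV :: real set) (Collect closed)"
    by (subst borel_eq_closed) (simp add: sets_measure_of)
  show "(\<lambda>\<nu>. emeasure (meas \<nu>) A) \<in> borel_measurable borel" if "A \<in> Collect closed" for A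
  proof -
    have "(\<lambda>\<nu>. measure (meas \<nu>) A) \<in> borel_measurable borel"
      by (rule borel_measurableI_less)
        (use that open_measure_closed_less[of A] in \<open>auto intro: borel_open\<close>)
    then show ?thesis
      by (simp add: finite_measure.emeasure_eq_measure[OF prob_space.finite_measure[OF prob_space_meas]])
  qed
qed (auto simp: Int_stable_def prob_space_meas)

lemmas measurable_meas_subprob [measurable] = measurable_prob_algebraD[OF measurable_meas]

text \<open>The integrand is integrated against a law that itself depends on the parameter; pushing the
  law forward to the product space reduces this to a fixed integrand.\<close>

lemma measurable_integral_meas:
  assumes "(\<lambda>(x, y). g x y) \<in> borel_measurable (M \<Otimes>\<^sub>M borel)" and m: "m \<in> borel_measurable M"
  shows "(\<lambda>x. \<integral>y. (g x y :: real) \<partial>meas (m x)) \<in> borel_measurable M"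
proof -
  have g: "(\<lambda>(x, y). g x y) \<in> borel_measurable (M \<Otimes>\<^sub>M borel)" by fact
  have L: "(\<lambda>x. meas (m x)) \<in> M \<rightarrow>\<^sub>M subprob_algebra borel"
    using measurable_compose[OF m measurable_meas_subprob] .
  have "(\<lambda>x. \<integral>z. (case z of (x, y) \<Rightarrow> g x y) \<partial>distr (meas (m x)) (M \<Otimes>\<^sub>M borel) (\<lambda>y. (x, y)))
      \<in> borel_measurable M"
    using g by (intro measurable_compose[OF measurable_distr2[OF _ L]
          integral_measurable_subprob_algebra]) auto
  then show ?thesis
    by (rule measurable_cong[THEN iffD1, rotated])
      (simp add: integral_distr g)
qed

text \<open>Measurability for the product \<open>\<sigma>\<close>-algebra, which may be smaller than the Borel sets of the
  product space: after rounding the relevant coordinates of \<open>x\<close> to a grid only countably many values of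
  \<open>x\<close> remain, each giving a function of \<open>\<nu>\<close> that is continuous, and refining the grid recovers \<open>f\<close>.\<close>

lemma measurable_Caratheodory_finite_coords:
  fixes f :: "(nat \<Rightarrow> real) \<Rightarrow> 'b::topological_space \<Rightarrow> real"
  assumes cont: "continuous_on UNIV (\<lambda>(x, \<nu>). f x \<nu>)"
    and dep: "\<And>x x' \<nu>. (\<And>i. i \<le> q \<Longrightarrow> x i = x' i) \<Longrightarrow> f x \<nu> = f x' \<nu>"
  shows "(\<lambda>(x, \<nu>). f x \<nu>) \<in> borel_measurable (Pi\<^sub>M UNIV (\<lambda>_. borel) \<Otimes>\<^sub>M borel)"
proof -
  define grid :: "nat \<Rightarrow> int list \<Rightarrow> nat \<Rightarrow> real"
    where "grid n zs = (\<lambda>i. if i \<le> q then real_of_int (zs ! i) / real (Suc n) else 0)" for n zs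
  define code :: "nat \<Rightarrow> (nat \<Rightarrow> real) \<Rightarrow> int list"
    where "code n x = map (\<lambda>i. \<lfloor>x i * real (Suc n)\<rfloor>) [0..<Suc q]" for n x
  let ?N = "(Pi\<^sub>M UNIV (\<lambda>_. borel) \<Otimes>\<^sub>M borel) :: ((nat \<Rightarrow> real) \<times> 'b) measure"
  have list_meas: "(\<lambda>x. map (\<lambda>i. \<lfloor>fst x i * real (Suc n)\<rfloor>) is) \<in> ?N \<rightarrow>\<^sub>M count_space UNIV" for n "is"
  proof (induction "is")
    case (Cons i "is")
    have "(\<lambda>x. \<lfloor>fst x i * real (Suc n)\<rfloor>) \<in> ?N \<rightarrow>\<^sub>M count_space UNIV"
      by measurable
    from measurable_compose_countable[OF _ this,
        of "\<lambda>z x. z # map (\<lambda>i. \<lfloor>fst x i * real (Suc n)\<rfloor>) is" "count_space UNIV"]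
    show ?case
      using measurable_compose[OF Cons.IH, of "(#) _" "count_space UNIV"] by (simp add: comp_def)
  qed simp
  have "(\<lambda>z. f (grid n (code n (fst z))) (snd z)) \<in> borel_measurable ?N" for n
  proof (rule measurable_compose_countable[where g="\<lambda>z. code n (fst z)"])
    fix zs
    have "continuous_on UNIV (\<lambda>\<nu>. (\<lambda>(x, \<nu>). f x \<nu>) (grid n zs, \<nu>))"
      by (intro continuous_on_compose2[OF cont] continuous_intros) auto
    then have "f (grid n zs) \<in> borel_measurable borel"
      by (intro borel_measurable_continuous_onI) simp
    then show "(\<lambda>z. f (grid n zs) (snd z)) \<in> borel_measurable ?N"
      by measurable
  qed (use list_meas[of n "[0..<Suc q]"] in \<open>simp add: code_def\<close>)
  moreover have "(\<lambda>n. f (grid n (code n (fst z))) (snd z)) \<longlonglongrightarrow> f (fst z) (snd z)" for z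
  proof -
    define x where "x = (\<lambda>i. if i \<le> q then fst z i else 0)"
    have lim1: "(\<lambda>n. grid n (code n (fst z)) i) \<longlonglongrightarrow> x i" for i
    proof (cases "i \<le> q")
      case True
      then have eq: "grid n (code n (fst z)) i = real_of_int \<lfloor>x i * real (Suc n)\<rfloor> / real (Suc n)" for n
        by (simp add: grid_def code_def x_def nth_append del: upt_Suc of_nat_Suc)
      have "(\<lambda>n. x i - inverse (real (Suc n))) \<longlonglongrightarrow> x i - 0"
        by (intro tendsto_intros LIMSEQ_inverse_real_of_nat)
      then have l: "(\<lambda>n. x i - inverse (real (Suc n))) \<longlonglongrightarrow> x i" by simp
      show ?thesis
        unfolding eq
      proof (rule tendsto_sandwich[OF _ _ l tendsto_const])
        have b: "x i * real (Suc n) - 1 \<le> real_of_int \<lfloor>x i * real (Suc n)\<rfloor>"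
          "real_of_int \<lfloor>x i * real (Suc n)\<rfloor> \<le> x i * real (Suc n)" for n
          by linarith+
        show "\<forall>\<^sub>F n in sequentially. x i - inverse (real (Suc n))
            \<le> real_of_int \<lfloor>x i * real (Suc n)\<rfloor> / real (Suc n)"
        proof (intro always_eventually allI)
          fix n
          show "x i - inverse (real (Suc n)) \<le> real_of_int \<lfloor>x i * real (Suc n)\<rfloor> / real (Suc n)"
            using divide_right_mono[OF b(1)[of n], of "real (Suc n)"]
            by (simp add: diff_divide_distrib inverse_eq_divide del: of_nat_Suc)
        qed
        show "\<forall>\<^sub>F n in sequentially. real_of_int \<lfloor>x i * real (Suc n)\<rfloor> / real (Suc n) \<le> x i"
          using b(2) by (intro always_eventually allI) (simp add: divide_le_eq del: of_nat_Suc)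
      qed
    qed (simp add: grid_def x_def)
    then have "(\<lambda>n. grid n (code n (fst z))) \<longlonglongrightarrow> x"
      using limitin_componentwise[of "\<lambda>_. euclidean" UNIV "\<lambda>n. grid n (code n (fst z))" x sequentially]
      by (simp add: euclidean_product_topology)
    then have "(\<lambda>n. (grid n (code n (fst z)), snd z)) \<longlonglongrightarrow> (x, snd z)"
      by (intro tendsto_Pair tendsto_const)
    from continuous_on_tendsto_compose[OF cont this]
    have "(\<lambda>n. f (grid n (code n (fst z))) (snd z)) \<longlonglongrightarrow> f x (snd z)" by simp
    also have "f x (snd z) = f (fst z) (snd z)" by (rule dep) (simp add: x_def)
    finally show ?thesis .
  qed
  ultimately have "(\<lambda>z. f (fst z) (snd z)) \<in> borel_measurable ?N"
    by (rule borel_measurable_LIMSEQ_real[rotated])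
  then show ?thesis by (simp add: split_beta)
qed

section \<open>Determining sequences converge stably\<close>

text \<open>Distribution functions are taken left-continuous here, \<open>F t = N(-\<infinity>, t)\<close>. Reflection in the
  origin turns them into one minus right-continuous ones, for which the Portmanteau theorem is
  stated.\<close>

lemma weak_conv_left_df:
  fixes M :: "nat \<Rightarrow> real measure" and g :: "real \<Rightarrow> real"
  assumes M: "\<And>n. real_distribution (M n)" and N: "real_distribution N"
    and conv: "\<And>t. isCont (\<lambda>t. measure N {..<t}) t \<Longrightarrow>
      (\<lambda>n. measure (M n) {..<t}) \<longlonglongrightarrow> measure N {..<t}"
    and g: "continuous_on UNIV g" "\<And>x. \<bar>g x\<bar> \<le> B"
  shows "(\<lambda>n. \<integral>x. g x \<partial>M n) \<longlonglongrightarrow> (\<integral>x. g x \<partial>N)"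
proof -
  define R where "R K = distr K borel (uminus :: real \<Rightarrow> real)" for K :: "real measure"
  have meas: "measurable K borel = measurable borel borel" if "real_distribution K" for K :: "real measure"
    by (rule measurable_cong_sets) (simp_all add: real_distribution.events_eq_borel[OF that])
  have R: "real_distribution (R K)" if "real_distribution K" for K
    unfolding R_def using that
    by (intro prob_space.real_distribution_distr) (auto simp: meas real_distribution_def)
  have cdf_R: "cdf (R K) s = 1 - measure K {..<-s}" if K: "real_distribution K" for K s
  proof -
    interpret K: real_distribution K by fact
    have "cdf (R K) s = measure K (space K - {..<-s})"
      unfolding cdf_def R_def
      by (subst measure_distr) (auto simp: meas[OF K] intro!: arg_cong[where f="measure K"])
    then show ?thesis by (subst (asm) K.prob_compl) auto
  qed
  have g_R: "(\<integral>x. g (- x) \<partial>R K) = (\<integral>x. g x \<partial>K)" if K: "real_distribution K" for K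
    unfolding R_def using borel_measurable_continuous_onI[OF g(1)]
    by (subst integral_distr) (auto simp: meas[OF K])
  have "weak_conv_m (\<lambda>n. R (M n)) (R N)"
    unfolding weak_conv_m_def weak_conv_def
  proof (intro allI impI)
    fix s assume "isCont (cdf (R N)) s"
    then have "isCont (\<lambda>t. 1 - cdf (R N) (- t)) (- s)"
      by (intro continuous_intros isCont_o2[of "- s" uminus]) auto
    then have "(\<lambda>n. measure (M n) {..<-s}) \<longlonglongrightarrow> measure N {..<-s}"
      by (intro conv) (simp add: cdf_R N)
    then show "(\<lambda>n. cdf (R (M n)) s) \<longlonglongrightarrow> cdf (R N) s"
      by (auto simp: cdf_R M N intro!: tendsto_intros)
  qed
  moreover have "isCont (\<lambda>x. g (- x)) x" for x
    using isCont_o2[of x uminus g] g(1) by (simp add: continuous_on_eq_continuous_at)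
  ultimately have "(\<lambda>n. \<integral>x. g (- x) \<partial>R (M n)) \<longlonglongrightarrow> (\<integral>x. g (- x) \<partial>R N)"
    using g(2) by (intro weak_conv_imp_integral_bdd_continuous_conv[OF R[OF M] R[OF N], where B=B]) auto
  then show ?thesis by (simp add: g_R M N)
qed

text \<open>Stable convergence in the sense of Renyi, the form in which the hypotheses on \<open>X\<close> and
  \<open>\<mu>\<close> are used.\<close>

locale stable_convergence = prob_space P for P :: "'a measure" and X :: "nat \<Rightarrow> 'a \<Rightarrow> real" and \<mu> :: "'a \<Rightarrow> borel_prob" +
  assumes X_measurable [measurable]: "\<And>n. X n \<in> borel_measurable P"
    and \<mu>_measurable [measurable]: "\<mu> \<in> borel_measurable P"
    and stable: "\<And>A g. A \<in> sets P \<Longrightarrow> continuous_on UNIV g \<Longrightarrow> (\<And>x. \<bar>g x :: real\<bar> \<le> 1) \<Longrightarrow>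
      (\<lambda>n. \<integral>\<omega>. indicator A \<omega> * g (X n \<omega>) \<partial>P)
        \<longlonglongrightarrow> (\<integral>\<omega>. indicator A \<omega> * (\<integral>y. g y \<partial>meas (\<mu> \<omega>)) \<partial>P)"

lemma integral_uniform_measure:
  fixes h :: "'a \<Rightarrow> real"
  assumes "A \<in> sets M" "emeasure M A \<noteq> 0" "emeasure M A \<noteq> \<infinity>" "h \<in> borel_measurable M"
  shows "(\<integral>x. h x \<partial>uniform_measure M A) = (\<integral>x. indicator A x * h x \<partial>M) / measure M A"
proof -
  have pos: "0 < measure M A"
    using assms by (simp add: measure_def enn2real_positive_iff less_top zero_less_iff_neq_zero)
  have "uniform_measure M A = density M (\<lambda>x. ennreal (indicator A x / measure M A))"
    unfolding uniform_measure_def using assms pos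
    by (intro density_cong)
      (auto simp: emeasure_eq_ennreal_measure divide_ennreal
        ennreal_indicator[symmetric] split: split_indicator)
  then show ?thesis
    using assms by (simp add: integral_density)
qed

text \<open>Both the limit law of \<open>X\<close> given \<open>A\<close> and the average of \<open>\<mu>\<close> over \<open>A\<close> are laws on the line whose
  distribution functions agree at the continuity points of the former, so they integrate continuous
  functions alike.\<close>

lemma determining_stable_convergence:
  assumes "prob_space P" and det: "determining P X" and lim: "limit_random_measure P X \<mu>"
  shows "stable_convergence P X \<mu>"
proof -
  interpret prob_space P by fact
  have X [measurable]: "\<And>n. X n \<in> borel_measurable P" using det by (simp add: determining_def)
  have mu [measurable]: "\<mu> \<in> borel_measurable P" using lim by (simp add: limit_random_measure_def)
  show ?thesis
  proof unfold_locales
    fix A and g :: "real \<Rightarrow> real"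
    assume A [measurable]: "A \<in> sets P" and g: "continuous_on UNIV g" "\<And>x. \<bar>g x\<bar> \<le> 1"
    have [measurable]: "g \<in> borel_measurable borel"
      using g(1) by (rule borel_measurable_continuous_onI)
    have [measurable]: "(\<lambda>\<omega>. \<integral>y. g y \<partial>meas (\<mu> \<omega>)) \<in> borel_measurable P"
      by (intro measurable_integral_meas) measurable
    show "(\<lambda>n. \<integral>\<omega>. indicator A \<omega> * g (X n \<omega>) \<partial>P)
        \<longlonglongrightarrow> (\<integral>\<omega>. indicator A \<omega> * (\<integral>y. g y \<partial>meas (\<mu> \<omega>)) \<partial>P)"
    proof (cases "measure P A = 0")
      case True
      then have "AE \<omega> in P. \<omega> \<notin> A"
        by (intro AE_not_in) (auto simp: null_sets_def emeasure_eq_measure)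
      then have "(\<integral>\<omega>. indicator A \<omega> * h \<omega> \<partial>P) = 0" for h :: "_ \<Rightarrow> real"
        by (intro integral_eq_zero_AE) (auto elim!: eventually_mono)
      then show ?thesis by simp
    next
      case False
      then have pos: "measure P A > 0" by (simp add: zero_less_measure_iff)
      define Q where "Q = uniform_measure P A"
      have emA: "emeasure P A \<noteq> 0" "emeasure P A \<noteq> \<infinity>"
        using pos by (auto simp: emeasure_eq_measure)
      interpret Q: prob_space Q
        unfolding Q_def using emA by (rule prob_space_uniform_measure)
      have sets_Q [measurable_cong, simp]: "sets Q = sets P" by (simp add: Q_def)
      have int_Q: "(\<integral>x. h x \<partial>Q) = (\<integral>x. indicator A x * h x \<partial>P) / measure P A"
        if "h \<in> borel_measurable P" for h
        unfolding Q_def using emA that by (intro integral_uniform_measure) auto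
      obtain F where F: "conditional_limit_df P X A F"
        using det A pos by (auto simp: determining_def)
      then obtain \<nu> where \<nu>: "\<And>t. F t = measure (meas \<nu>) {..<t}"
        by (auto simp: conditional_limit_df_def distribution_function_def)
      then have F_eq: "F = (\<lambda>t. measure (meas \<nu>) {..<t})" by auto
      have K [measurable]: "(\<lambda>\<omega>. meas (\<mu> \<omega>)) \<in> Q \<rightarrow>\<^sub>M subprob_algebra borel"
        using measurable_compose[OF mu measurable_meas_subprob] by simp
      define N where "N = Q \<bind> (\<lambda>\<omega>. meas (\<mu> \<omega>))"
      have N: "real_distribution N"
        unfolding N_def real_distribution_def real_distribution_axioms_def
        by (auto intro!: Q.prob_space_bind[where S=borel] simp: prob_space_meas sets_bind[OF _ Q.not_empty])
      have int_N: "(\<integral>x. h x \<partial>N) = (\<integral>\<omega>. \<integral>y. h y \<partial>meas (\<mu> \<omega>) \<partial>Q)"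
        if "h \<in> borel_measurable borel" "\<And>x. \<bar>h x\<bar> \<le> 1" for h :: "real \<Rightarrow> real"
        unfolding N_def using that
        by (intro integral_bind[where K=borel and B=1 and B'=1])
          (auto simp: prob_space.emeasure_space_1[OF prob_space_meas] Q.finite_measure_axioms)
      \<comment> \<open>The law \<open>N\<close> is compared with \<open>\<nu>\<close> by regarding it as a constant sequence converging to \<open>\<nu>\<close>.\<close>
      have "measure N {..<t} = (\<integral>\<omega>. measure (meas (\<mu> \<omega>)) {..<t} \<partial>Q)" for t
        using int_N[of "indicator {..<t}"] real_distribution.events_eq_borel[OF N]
          sets_eq_imp_space_eq[OF sets_meas] sets_eq_imp_space_eq[OF real_distribution.events_eq_borel[OF N]]
        by simp
      then have "measure N {..<t} = measure (meas \<nu>) {..<t}"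
        if "isCont (\<lambda>t. measure (meas \<nu>) {..<t}) t" for t
        using lim A pos F that unfolding limit_random_measure_def Q_def F_eq by auto
      then have "(\<lambda>_. \<integral>x. g x \<partial>N) \<longlonglongrightarrow> (\<integral>x. g x \<partial>meas \<nu>)"
        using N g real_distribution_meas by (intro weak_conv_left_df) auto
      then have eq: "(\<integral>x. g x \<partial>N) = (\<integral>x. g x \<partial>meas \<nu>)"
        using LIMSEQ_unique tendsto_const by blast
      have "(\<lambda>n. \<integral>x. g x \<partial>distr Q borel (X n)) \<longlonglongrightarrow> (\<integral>x. g x \<partial>meas \<nu>)"
      proof (rule weak_conv_left_df[OF _ real_distribution_meas _ g])
        show "real_distribution (distr Q borel (X n))" for n
          by (intro Q.real_distribution_distr) simp
        fix t assume t: "isCont (\<lambda>t. measure (meas \<nu>) {..<t}) t"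
        have sp: "space Q = space P" by (simp add: Q_def)
        have "measure (distr Q borel (X n)) {..<t} = \<P>(\<omega> in P. X n \<omega> < t \<bar> \<omega> \<in> A)" for n
        proof -
          have *: "A \<inter> (X n -` {..<t} \<inter> space P) = {\<omega> \<in> space P. X n \<omega> < t \<and> \<omega> \<in> A}"
            "A = {\<omega> \<in> space P. \<omega> \<in> A}"
            using sets.sets_into_space[OF A] by auto
          have "measure (distr Q borel (X n)) {..<t} = measure Q (X n -` {..<t} \<inter> space P)"
            by (subst measure_distr) (auto simp: sp)
          also have "\<dots> = measure P (A \<inter> (X n -` {..<t} \<inter> space P)) / measure P A"
            unfolding Q_def using emA by (intro measure_uniform_measure) auto
          also have "\<dots> = \<P>(\<omega> in P. X n \<omega> < t \<bar> \<omega> \<in> A)"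
            unfolding cond_prob_def *(1) by (subst (2) *(2)) simp
          finally show ?thesis .
        qed
        then show "(\<lambda>n. measure (distr Q borel (X n)) {..<t}) \<longlonglongrightarrow> measure (meas \<nu>) {..<t}"
          using F t unfolding conditional_limit_df_def F_eq by auto
      qed
      also have "(\<lambda>n. \<integral>x. g x \<partial>distr Q borel (X n)) = (\<lambda>n. \<integral>\<omega>. g (X n \<omega>) \<partial>Q)"
        by (simp add: integral_distr)
      also have "(\<integral>x. g x \<partial>meas \<nu>) = (\<integral>\<omega>. \<integral>y. g y \<partial>meas (\<mu> \<omega>) \<partial>Q)"
        unfolding eq[symmetric] using g(2) by (intro int_N) auto
      finally have "(\<lambda>n. (\<integral>\<omega>. indicator A \<omega> * g (X n \<omega>) \<partial>P) / measure P A)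
          \<longlonglongrightarrow> (\<integral>\<omega>. indicator A \<omega> * (\<integral>y. g y \<partial>meas (\<mu> \<omega>)) \<partial>P) / measure P A"
        by (simp add: int_Q)
      from tendsto_mult[OF this tendsto_const[of "measure P A"]] show ?thesis
        using pos by simp
    qed
  qed fact+
qed

lemma space_meas [simp]: "space (meas \<nu>) = UNIV"
  using sets_eq_imp_space_eq[OF sets_meas[of \<nu>]] by simp

lemma integrable_meas_bounded:
  fixes h :: "real \<Rightarrow> real"
  assumes "h \<in> borel_measurable borel" "\<And>y. \<bar>h y\<bar> \<le> B"
  shows "integrable (meas \<nu>) h"
proof -
  interpret prob_space "meas \<nu>" by (rule prob_space_meas)
  show ?thesis using assms by (intro integrable_const_bound[where B=B]) auto
qed

lemma measure_meas_UNIV [simp]: "measure (meas \<nu>) UNIV = 1"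
  using prob_space.prob_space[OF prob_space_meas[of \<nu>]] by simp

lemma abs_integral_meas_le:
  fixes h :: "real \<Rightarrow> real"
  assumes "h \<in> borel_measurable borel" "\<And>y. \<bar>h y\<bar> \<le> B"
  shows "\<bar>\<integral>y. h y \<partial>meas \<nu>\<bar> \<le> B"
proof -
  have "\<bar>\<integral>y. h y \<partial>meas \<nu>\<bar> \<le> (\<integral>y. \<bar>h y\<bar> \<partial>meas \<nu>)" by (rule integral_abs_bound)
  also have "\<dots> \<le> (\<integral>y. B \<partial>meas \<nu>)"
    using assms order_trans[OF abs_ge_zero assms(2)]
    by (intro integral_mono integrable_meas_bounded[where B=B]) auto
  finally show ?thesis by simp
qed

lemma LIMSEQ_approximation:
  fixes a :: "nat \<Rightarrow> real"
  assumes "\<And>e. e > 0 \<Longrightarrow> \<exists>b L' c l. b \<longlonglongrightarrow> L' \<and> c \<longlonglongrightarrow> l \<and> l < e \<and>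
    (\<forall>n. \<bar>a n - b n\<bar> \<le> c n) \<and> \<bar>L - L'\<bar> \<le> l"
  shows "a \<longlonglongrightarrow> L"
proof (rule metric_LIMSEQ_I)
  fix r :: real assume "0 < r"
  then obtain b L' c l where *: "b \<longlonglongrightarrow> L'" "c \<longlonglongrightarrow> l" "l < r / 3"
    "\<And>n. \<bar>a n - b n\<bar> \<le> c n" "\<bar>L - L'\<bar> \<le> l"
    using assms[of "r / 3"] by auto
  have "\<forall>\<^sub>F n in sequentially. dist (b n) L' < r / 3"
    using * \<open>0 < r\<close> by (intro tendstoD) auto
  moreover have "\<forall>\<^sub>F n in sequentially. c n < r / 3"
    using * by (intro order_tendstoD(2)) auto
  ultimately have "\<forall>\<^sub>F n in sequentially. dist (a n) L < r"
  proof eventually_elim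
    case (elim n)
    then show ?case using *(3) *(4)[of n] *(5) unfolding dist_real_def by linarith
  qed
  then show "\<exists>no. \<forall>n\<ge>no. dist (a n) L < r" by (simp add: eventually_sequentially)
qed

context stable_convergence
begin

context
  fixes h :: "'a \<Rightarrow> real \<Rightarrow> real" and B :: real
  assumes h [measurable]: "(\<lambda>(\<omega>, y). h \<omega> y) \<in> borel_measurable (P \<Otimes>\<^sub>M borel)"
    and bounded: "\<And>\<omega> y. \<omega> \<in> space P \<Longrightarrow> \<bar>h \<omega> y\<bar> \<le> B"
begin

lemma measurable_section: "\<omega> \<in> space P \<Longrightarrow> h \<omega> \<in> borel_measurable borel"
  using measurable_Pair2[OF h] by simp

lemma measurable_subst_X: "(\<lambda>\<omega>. h \<omega> (X n \<omega>)) \<in> borel_measurable P"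
  using measurable_compose[OF measurable_Pair[OF measurable_ident X_measurable[of n]] h] by simp

lemma integrable_subst_X: "integrable P (\<lambda>\<omega>. h \<omega> (X n \<omega>))"
  by (intro integrable_const_bound[where B=B] AE_I2 measurable_subst_X) (simp add: bounded)

lemma integrable_section: "\<omega> \<in> space P \<Longrightarrow> integrable (meas \<nu>) (h \<omega>)"
  by (intro integrable_meas_bounded[where B=B] measurable_section bounded)

lemma integrable_average: "integrable P (\<lambda>\<omega>. \<integral>y. h \<omega> y \<partial>meas (\<mu> \<omega>))"
  by (intro integrable_const_bound[where B=B] AE_I2 measurable_integral_meas h \<mu>_measurable)
    (simp add: abs_integral_meas_le measurable_section bounded)

end

lemma average_tendsto_zero:
  fixes h :: "nat \<Rightarrow> 'a \<Rightarrow> real \<Rightarrow> real"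
  assumes meas: "\<And>k. (\<lambda>(\<omega>, y). h k \<omega> y) \<in> borel_measurable (P \<Otimes>\<^sub>M borel)"
    and range: "\<And>k \<omega> y. \<omega> \<in> space P \<Longrightarrow> 0 \<le> h k \<omega> y \<and> h k \<omega> y \<le> 1"
    and lim: "\<And>\<omega> y. \<omega> \<in> space P \<Longrightarrow> (\<lambda>k. h k \<omega> y) \<longlonglongrightarrow> 0"
  shows "(\<lambda>k. \<integral>\<omega>. \<integral>y. h k \<omega> y \<partial>meas (\<mu> \<omega>) \<partial>P) \<longlonglongrightarrow> 0"
proof -
  have abs1: "\<bar>h k \<omega> y\<bar> \<le> 1" if "\<omega> \<in> space P" for k \<omega> y
    using range[OF that, of k y] by simp
  have sec: "h k \<omega> \<in> borel_measurable borel" if "\<omega> \<in> space P" for k \<omega>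
    using measurable_section[of "h k" 1 \<omega>] meas abs1 that by blast
  have "(\<lambda>k. \<integral>\<omega>. \<integral>y. h k \<omega> y \<partial>meas (\<mu> \<omega>) \<partial>P) \<longlonglongrightarrow> (\<integral>\<omega>. 0 \<partial>P)"
  proof (rule integral_dominated_convergence[where w="\<lambda>_. 1"])
    show "AE \<omega> in P. (\<lambda>k. \<integral>y. h k \<omega> y \<partial>meas (\<mu> \<omega>)) \<longlonglongrightarrow> 0"
    proof (rule AE_I2)
      fix \<omega> assume \<omega>: "\<omega> \<in> space P"
      have "(\<lambda>k. \<integral>y. h k \<omega> y \<partial>meas (\<mu> \<omega>)) \<longlonglongrightarrow> (\<integral>y. 0 \<partial>meas (\<mu> \<omega>))"
      proof (rule integral_dominated_convergence[where w="\<lambda>_. 1"])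
        show "AE y in meas (\<mu> \<omega>). norm (h k \<omega> y) \<le> 1" for k
          using abs1[OF \<omega>] by simp
      next
        show "h k \<omega> \<in> borel_measurable (meas (\<mu> \<omega>))" for k
          using sec[OF \<omega>] by simp
      qed (auto simp: lim[OF \<omega>] integrable_meas_bounded[where B=1])
      then show "(\<lambda>k. \<integral>y. h k \<omega> y \<partial>meas (\<mu> \<omega>)) \<longlonglongrightarrow> 0" by simp
    qed
    show "AE \<omega> in P. norm (\<integral>y. h k \<omega> y \<partial>meas (\<mu> \<omega>)) \<le> 1" for k
      using abs_integral_meas_le[OF sec abs1] by (intro AE_I2) simp
  qed (auto intro!: measurable_integral_meas meas)
  then show ?thesis by simp
qed

lemma stable_const:
  assumes "continuous_on UNIV g" "\<And>x. \<bar>g x :: real\<bar> \<le> 1"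
  shows "(\<lambda>n. \<integral>\<omega>. g (X n \<omega>) \<partial>P) \<longlonglongrightarrow> (\<integral>\<omega>. \<integral>y. g y \<partial>meas (\<mu> \<omega>) \<partial>P)"
proof -
  have "(\<integral>\<omega>. indicator (space P) \<omega> * k \<omega> \<partial>P) = (\<integral>\<omega>. k \<omega> \<partial>P)" for k :: "'a \<Rightarrow> real"
    by (intro Bochner_Integration.integral_cong) auto
  with stable[OF sets.top assms] show ?thesis by simp
qed

text \<open>Stable convergence for integrands in which \<open>\<omega>\<close> and the value of \<open>X\<^sub>n\<close> interact. By
  equicontinuity and up to a small tail, the function \<open>\<phi> \<omega>\<close> is determined by its values on a finite grid,
  and these may be rounded. So \<open>\<phi>\<close> is uniformly close to an integrand that takes finitely many
  functions of \<open>y\<close> as values, each on an event, and for such the claim is the definition.\<close>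

lemma stable_Caratheodory:
  fixes \<phi> :: "'a \<Rightarrow> real \<Rightarrow> real"
  assumes meas [measurable]: "(\<lambda>(\<omega>, y). \<phi> \<omega> y) \<in> borel_measurable (P \<Otimes>\<^sub>M borel)"
    and range: "\<And>\<omega> y. \<omega> \<in> space P \<Longrightarrow> 0 \<le> \<phi> \<omega> y \<and> \<phi> \<omega> y \<le> 1"
    and equi: "\<And>e. e > 0 \<Longrightarrow> \<exists>d>0. \<forall>\<omega>\<in>space P. \<forall>y y'. \<bar>y - y'\<bar> < d \<longrightarrow> \<bar>\<phi> \<omega> y - \<phi> \<omega> y'\<bar> \<le> e"
  shows "(\<lambda>n. \<integral>\<omega>. \<phi> \<omega> (X n \<omega>) \<partial>P) \<longlonglongrightarrow> (\<integral>\<omega>. \<integral>y. \<phi> \<omega> y \<partial>meas (\<mu> \<omega>) \<partial>P)"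
proof (rule LIMSEQ_approximation)
  fix \<epsilon> :: real assume "0 < \<epsilon>"
  define e where "e = \<epsilon> / 4"
  have e: "0 < e" using \<open>0 < \<epsilon>\<close> by (simp add: e_def)
  have abs1: "\<omega> \<in> space P \<Longrightarrow> \<bar>\<phi> \<omega> y\<bar> \<le> 1" for \<omega> y using range[of \<omega> y] by simp
  define tail :: "real \<Rightarrow> real \<Rightarrow> real" where "tail K y = min 1 (max 0 (\<bar>y\<bar> - K))" for K y
  have tail_cont: "continuous_on UNIV (tail K)" for K
    unfolding tail_def by (intro continuous_intros)
  then have tail_meas [measurable]: "tail K \<in> borel_measurable borel" for K
    by (rule borel_measurable_continuous_onI)
  have tail_bd: "\<bar>tail K y\<bar> \<le> 1" "0 \<le> tail K y" "tail K y \<le> 1" for K y by (auto simp: tail_def)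
  have tail_joint [measurable]: "(\<lambda>(\<omega>, y). tail K y) \<in> borel_measurable (P \<Otimes>\<^sub>M borel)" for K
    by measurable
  have tail_lim: "(\<lambda>k. tail (real k) y) \<longlonglongrightarrow> 0" for y
  proof (rule tendsto_eventually)
    obtain k0 where "\<bar>y\<bar> \<le> real k0" using real_arch_simple by blast
    then have "tail (real k) y = 0" if "k \<ge> k0" for k
      using that by (simp add: tail_def min_def max_def)
    then show "\<forall>\<^sub>F k in sequentially. tail (real k) y = 0"
      unfolding eventually_sequentially by blast
  qed
  have "(\<lambda>k. \<integral>\<omega>. \<integral>y. tail (real k) y \<partial>meas (\<mu> \<omega>) \<partial>P) \<longlonglongrightarrow> 0"
    by (rule average_tendsto_zero) (auto simp: tail_bd tail_lim)
  then have "\<forall>\<^sub>F k in sequentially. (\<integral>\<omega>. \<integral>y. tail (real k) y \<partial>meas (\<mu> \<omega>) \<partial>P) < e"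
    using e by (intro order_tendstoD(2)) auto
  then obtain k where k: "(\<integral>\<omega>. \<integral>y. tail (real k) y \<partial>meas (\<mu> \<omega>) \<partial>P) < e"
    by (auto simp: eventually_sequentially)
  obtain d where d: "0 < d"
    "\<And>\<omega> y y'. \<omega> \<in> space P \<Longrightarrow> \<bar>y - y'\<bar> < d \<Longrightarrow> \<bar>\<phi> \<omega> y - \<phi> \<omega> y'\<bar> \<le> e"
    using equi[OF e] by blast
  \<comment> \<open>Grid points are \<open>d/2\<close> apart, and cover \<open>[-(k+1), k+1]\<close>; beyond that interval \<open>tail\<close> equals \<open>1\<close>.\<close>
  define grid where "grid i = real_of_int i * (d / 2)" for i
  define m where "m = \<lceil>(real k + 1) / (d / 2)\<rceil> + 1"
  define I where "I = {-m..m}"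
  have fin_I: "finite I" by (simp add: I_def)
  define code where "code \<omega> = (\<lambda>i\<in>I. \<lfloor>\<phi> \<omega> (grid i) / e\<rfloor>)" for \<omega>
  have close: "\<bar>\<phi> \<omega> y - \<phi> \<omega>' y\<bar> \<le> 3 * e + tail (real k) y"
    if \<omega>: "\<omega> \<in> space P" "\<omega>' \<in> space P" "code \<omega> = code \<omega>'" for \<omega> \<omega>' y
  proof (cases "\<bar>y\<bar> \<le> real k + 1")
    case True
    define i where "i = \<lfloor>y / (d / 2)\<rfloor>"
    have "i \<in> I"
    proof -
      have "\<bar>y / (d / 2)\<bar> \<le> (real k + 1) / (d / 2)"
        using True d(1) by (simp add: abs_divide divide_right_mono)
      then have "- (\<lceil>(real k + 1) / (d / 2)\<rceil> + 1) \<le> \<lfloor>y / (d / 2)\<rfloor> \<and>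
          \<lfloor>y / (d / 2)\<rfloor> \<le> \<lceil>(real k + 1) / (d / 2)\<rceil> + 1"
        by linarith
      then show ?thesis unfolding I_def i_def m_def atLeastAtMost_iff .
    qed
    have "real_of_int i \<le> y / (d / 2)" "y / (d / 2) < real_of_int i + 1"
      unfolding i_def by linarith+
    then have "grid i \<le> y" "y < grid i + d / 2"
      using d(1) by (auto simp: grid_def field_simps)
    then have "\<bar>y - grid i\<bar> < d" using d(1) by linarith
    then have *: "\<bar>\<phi> \<omega> y - \<phi> \<omega> (grid i)\<bar> \<le> e" "\<bar>\<phi> \<omega>' y - \<phi> \<omega>' (grid i)\<bar> \<le> e"
      using d(2) \<omega> by auto
    have "\<lfloor>\<phi> \<omega> (grid i) / e\<rfloor> = \<lfloor>\<phi> \<omega>' (grid i) / e\<rfloor>"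
      using fun_cong[OF \<omega>(3), of i] \<open>i \<in> I\<close> by (simp add: code_def)
    then have "\<bar>\<phi> \<omega> (grid i) / e - \<phi> \<omega>' (grid i) / e\<bar> < 1"
      by linarith
    then have "\<bar>\<phi> \<omega> (grid i) - \<phi> \<omega>' (grid i)\<bar> < e"
      using e by (simp add: diff_divide_distrib[symmetric] abs_divide)
    with * tail_bd(2)[of "real k" y] show ?thesis by linarith
  next
    case False
    then have "tail (real k) y = 1" by (simp add: tail_def)
    then show ?thesis using range[OF \<omega>(1), of y] range[OF \<omega>(2), of y] e by auto
  qed
  define V where "V = code ` space P"
  have "V \<subseteq> PiE I (\<lambda>_. {0..\<lfloor>1 / e\<rfloor>})"
    unfolding V_def code_def
    using range e by (fastforce intro!: floor_mono divide_right_mono)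
  then have fin_V: "finite V"
    by (rule finite_subset) (intro finite_PiE fin_I, simp)
  \<comment> \<open>Each event \<open>A v\<close>, on which the rounded values are \<open>v\<close>, is represented by one of its points.\<close>
  define rep where "rep v = (SOME \<omega>. \<omega> \<in> space P \<and> code \<omega> = v)" for v
  have rep: "rep v \<in> space P" "code (rep v) = v" if "v \<in> V" for v
  proof -
    have "\<exists>\<omega>. \<omega> \<in> space P \<and> code \<omega> = v" using that by (auto simp: V_def)
    from someI_ex[OF this] show "rep v \<in> space P" "code (rep v) = v" by (auto simp: rep_def)
  qed
  define A where "A v = {\<omega> \<in> space P. code \<omega> = v}" for v
  have A [measurable]: "A v \<in> sets P" if "v \<in> V" for v
  proof -
    have *: "(\<lambda>\<omega>. \<phi> \<omega> (grid i)) \<in> borel_measurable P" for i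
      by measurable
    have "A v = {\<omega> \<in> space P. \<forall>i\<in>I. \<lfloor>\<phi> \<omega> (grid i) / e\<rfloor> = v i}"
      using that by (auto simp: A_def V_def code_def fun_eq_iff restrict_def)
    also have "\<dots> \<in> sets P"
      using fin_I by (intro sets.sets_Collect_finite_All) (use * in measurable)
    finally show ?thesis .
  qed
  define \<psi> where "\<psi> \<omega> y = (\<Sum>v\<in>V. indicator (A v) \<omega> * \<phi> (rep v) y)" for \<omega> y
  have rep_meas [measurable]: "v \<in> V \<Longrightarrow> \<phi> (rep v) \<in> borel_measurable borel" for v
    using measurable_section[OF meas abs1] rep by blast
  have \<psi>_meas [measurable]: "(\<lambda>(\<omega>, y). \<psi> \<omega> y) \<in> borel_measurable (P \<Otimes>\<^sub>M borel)"
    unfolding \<psi>_def by measurable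
  have \<psi>_eq: "\<psi> \<omega> y = \<phi> (rep (code \<omega>)) y" if "\<omega> \<in> space P" for \<omega> y
  proof -
    have "\<psi> \<omega> y = (\<Sum>v\<in>V. if v = code \<omega> then \<phi> (rep v) y else 0)"
      unfolding \<psi>_def using that by (intro sum.cong) (auto simp: A_def)
    also have "\<dots> = \<phi> (rep (code \<omega>)) y"
      using fin_V that by (subst sum.delta) (auto simp: V_def)
    finally show ?thesis .
  qed
  have \<psi>_bd: "\<bar>\<psi> \<omega> y\<bar> \<le> 1" if "\<omega> \<in> space P" for \<omega> y
    using that rep(1)[of "code \<omega>"] by (auto simp: \<psi>_eq V_def intro: abs1)
  have diff: "\<bar>\<phi> \<omega> y - \<psi> \<omega> y\<bar> \<le> 3 * e + tail (real k) y" if "\<omega> \<in> space P" for \<omega> y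
    unfolding \<psi>_eq[OF that] using that rep[of "code \<omega>"] by (intro close) (auto simp: V_def)
  note ints = integrable_subst_X[OF meas abs1] integrable_average[OF meas abs1]
    integrable_section[OF meas abs1] integrable_subst_X[OF \<psi>_meas \<psi>_bd]
    integrable_average[OF \<psi>_meas \<psi>_bd] integrable_section[OF \<psi>_meas \<psi>_bd]
    integrable_subst_X[OF tail_joint tail_bd(1)] integrable_average[OF tail_joint tail_bd(1)]
    integrable_meas_bounded[OF tail_meas tail_bd(1)]
  have rep_cont: "continuous_on UNIV (\<phi> (rep v))" if "v \<in> V" for v
    unfolding continuous_on_iff
  proof (intro ballI allI impI)
    fix x r :: real assume "0 < r"
    then obtain d where "d > 0" "\<forall>\<omega>\<in>space P. \<forall>y y'. \<bar>y - y'\<bar> < d \<longrightarrow> \<bar>\<phi> \<omega> y - \<phi> \<omega> y'\<bar> \<le> r / 2"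
      using equi[of "r / 2"] by auto
    then show "\<exists>d>0. \<forall>x'\<in>UNIV. dist x' x < d \<longrightarrow> dist (\<phi> (rep v) x') (\<phi> (rep v) x) < r"
      using rep(1)[OF that] \<open>0 < r\<close> by (force simp: dist_real_def intro!: exI[of _ d])
  qed
  have conv_\<psi>: "(\<lambda>n. \<integral>\<omega>. \<psi> \<omega> (X n \<omega>) \<partial>P) \<longlonglongrightarrow> (\<integral>\<omega>. \<integral>y. \<psi> \<omega> y \<partial>meas (\<mu> \<omega>) \<partial>P)"
  proof -
    have int_v: "integrable (meas \<nu>) (\<phi> (rep v))" if "v \<in> V" for v \<nu>
      using that rep(1)[of v] by (intro integrable_meas_bounded[where B=1] rep_meas abs1)
    have "(\<lambda>n. \<Sum>v\<in>V. \<integral>\<omega>. indicator (A v) \<omega> * \<phi> (rep v) (X n \<omega>) \<partial>P) \<longlonglongrightarrow>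
        (\<Sum>v\<in>V. \<integral>\<omega>. indicator (A v) \<omega> * (\<integral>y. \<phi> (rep v) y \<partial>meas (\<mu> \<omega>)) \<partial>P)"
      using A rep_cont abs1 rep(1) by (intro tendsto_sum stable) auto
    also have "(\<lambda>n. \<Sum>v\<in>V. \<integral>\<omega>. indicator (A v) \<omega> * \<phi> (rep v) (X n \<omega>) \<partial>P) =
        (\<lambda>n. \<integral>\<omega>. \<psi> \<omega> (X n \<omega>) \<partial>P)"
      unfolding \<psi>_def
      by (intro ext Bochner_Integration.integral_sum[symmetric] integrable_const_bound[where B=1] AE_I2)
        (auto simp: abs_mult intro!: abs1 rep split: split_indicator)
    also have "(\<Sum>v\<in>V. \<integral>\<omega>. indicator (A v) \<omega> * (\<integral>y. \<phi> (rep v) y \<partial>meas (\<mu> \<omega>)) \<partial>P) =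
        (\<integral>\<omega>. (\<Sum>v\<in>V. indicator (A v) \<omega> * (\<integral>y. \<phi> (rep v) y \<partial>meas (\<mu> \<omega>))) \<partial>P)"
      using rep(1)
      by (intro Bochner_Integration.integral_sum[symmetric] integrable_const_bound[where B=1] AE_I2)
        (auto simp: abs_mult intro!: abs_integral_meas_le abs1 rep_meas borel_measurable_times
          measurable_integral_meas split: split_indicator)
    also have "\<dots> = (\<integral>\<omega>. \<integral>y. \<psi> \<omega> y \<partial>meas (\<mu> \<omega>) \<partial>P)"
      unfolding \<psi>_def using int_v
      by (intro Bochner_Integration.integral_cong refl) (simp add: Bochner_Integration.integral_sum)
    finally show ?thesis .
  qed
  have "(\<lambda>n. 3 * e + (\<integral>\<omega>. tail (real k) (X n \<omega>) \<partial>P)) \<longlonglongrightarrow>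
      3 * e + (\<integral>\<omega>. \<integral>y. tail (real k) y \<partial>meas (\<mu> \<omega>) \<partial>P)"
    by (intro tendsto_intros stable_const tail_cont tail_bd)
  moreover have "\<bar>(\<integral>\<omega>. \<phi> \<omega> (X n \<omega>) \<partial>P) - (\<integral>\<omega>. \<psi> \<omega> (X n \<omega>) \<partial>P)\<bar>
      \<le> 3 * e + (\<integral>\<omega>. tail (real k) (X n \<omega>) \<partial>P)" for n
  proof -
    have "\<bar>(\<integral>\<omega>. \<phi> \<omega> (X n \<omega>) \<partial>P) - (\<integral>\<omega>. \<psi> \<omega> (X n \<omega>) \<partial>P)\<bar>
        = \<bar>\<integral>\<omega>. \<phi> \<omega> (X n \<omega>) - \<psi> \<omega> (X n \<omega>) \<partial>P\<bar>"
      using ints by (subst Bochner_Integration.integral_diff) auto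
    also have "\<dots> \<le> (\<integral>\<omega>. \<bar>\<phi> \<omega> (X n \<omega>) - \<psi> \<omega> (X n \<omega>)\<bar> \<partial>P)" by (rule integral_abs_bound)
    also have "\<dots> \<le> (\<integral>\<omega>. 3 * e + tail (real k) (X n \<omega>) \<partial>P)"
      using ints diff by (intro integral_mono) auto
    also have "\<dots> = 3 * e + (\<integral>\<omega>. tail (real k) (X n \<omega>) \<partial>P)"
      using ints by (subst Bochner_Integration.integral_add) (auto simp: prob_space)
    finally show ?thesis .
  qed
  moreover have "\<bar>(\<integral>\<omega>. \<integral>y. \<phi> \<omega> y \<partial>meas (\<mu> \<omega>) \<partial>P) - (\<integral>\<omega>. \<integral>y. \<psi> \<omega> y \<partial>meas (\<mu> \<omega>) \<partial>P)\<bar>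
      \<le> 3 * e + (\<integral>\<omega>. \<integral>y. tail (real k) y \<partial>meas (\<mu> \<omega>) \<partial>P)"
  proof -
    have "\<bar>(\<integral>\<omega>. \<integral>y. \<phi> \<omega> y \<partial>meas (\<mu> \<omega>) \<partial>P) - (\<integral>\<omega>. \<integral>y. \<psi> \<omega> y \<partial>meas (\<mu> \<omega>) \<partial>P)\<bar>
        = \<bar>\<integral>\<omega>. (\<integral>y. \<phi> \<omega> y \<partial>meas (\<mu> \<omega>)) - (\<integral>y. \<psi> \<omega> y \<partial>meas (\<mu> \<omega>)) \<partial>P\<bar>"
      using ints by (subst Bochner_Integration.integral_diff) auto
    also have "\<dots> \<le> (\<integral>\<omega>. \<bar>(\<integral>y. \<phi> \<omega> y \<partial>meas (\<mu> \<omega>)) - (\<integral>y. \<psi> \<omega> y \<partial>meas (\<mu> \<omega>))\<bar> \<partial>P)"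
      by (rule integral_abs_bound)
    also have "\<dots> \<le> (\<integral>\<omega>. 3 * e + (\<integral>y. tail (real k) y \<partial>meas (\<mu> \<omega>)) \<partial>P)"
    proof (rule integral_mono)
      fix \<omega> assume \<omega>: "\<omega> \<in> space P"
      have "\<bar>(\<integral>y. \<phi> \<omega> y \<partial>meas (\<mu> \<omega>)) - (\<integral>y. \<psi> \<omega> y \<partial>meas (\<mu> \<omega>))\<bar>
          = \<bar>\<integral>y. \<phi> \<omega> y - \<psi> \<omega> y \<partial>meas (\<mu> \<omega>)\<bar>"
        using ints \<omega> by (subst Bochner_Integration.integral_diff) auto
      also have "\<dots> \<le> (\<integral>y. \<bar>\<phi> \<omega> y - \<psi> \<omega> y\<bar> \<partial>meas (\<mu> \<omega>))" by (rule integral_abs_bound)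
      also have "\<dots> \<le> (\<integral>y. 3 * e + tail (real k) y \<partial>meas (\<mu> \<omega>))"
        using ints diff[OF \<omega>] \<omega> prob_space.finite_measure[OF prob_space_meas]
        by (intro integral_mono Bochner_Integration.integrable_add finite_measure.integrable_const) auto
      also have "\<dots> = 3 * e + (\<integral>y. tail (real k) y \<partial>meas (\<mu> \<omega>))"
        using ints prob_space.finite_measure[OF prob_space_meas]
        by (subst Bochner_Integration.integral_add) (auto intro!: finite_measure.integrable_const)
      finally show "\<bar>(\<integral>y. \<phi> \<omega> y \<partial>meas (\<mu> \<omega>)) - (\<integral>y. \<psi> \<omega> y \<partial>meas (\<mu> \<omega>))\<bar>
          \<le> 3 * e + (\<integral>y. tail (real k) y \<partial>meas (\<mu> \<omega>))" .
    qed (use ints in auto)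
    also have "\<dots> = 3 * e + (\<integral>\<omega>. \<integral>y. tail (real k) y \<partial>meas (\<mu> \<omega>) \<partial>P)"
      using ints by (subst Bochner_Integration.integral_add) (auto simp: prob_space)
    finally show ?thesis .
  qed
  moreover have "3 * e + (\<integral>\<omega>. \<integral>y. tail (real k) y \<partial>meas (\<mu> \<omega>) \<partial>P) < \<epsilon>"
    using k by (simp add: e_def)
  ultimately show "\<exists>b L' c l. b \<longlonglongrightarrow> L' \<and> c \<longlonglongrightarrow> l \<and> l < \<epsilon> \<and>
      (\<forall>n. \<bar>(\<integral>\<omega>. \<phi> \<omega> (X n \<omega>) \<partial>P) - b n\<bar> \<le> c n) \<and>
      \<bar>(\<integral>\<omega>. \<integral>y. \<phi> \<omega> y \<partial>meas (\<mu> \<omega>) \<partial>P) - L'\<bar> \<le> l"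
    using conv_\<psi> by blast
qed

end

section \<open>The cost of changing one coordinate\<close>

lemma powr_subadditive:
  fixes u v :: real
  assumes "0 \<le> u" "0 \<le> v" "0 < \<alpha>" "\<alpha> \<le> 1"
  shows "(u + v) powr \<alpha> \<le> u powr \<alpha> + v powr \<alpha>"
proof (cases "u + v = 0")
  case False
  define s where "s = u + v"
  have s: "s > 0" using False assms by (simp add: s_def)
  have *: "t / s * s powr \<alpha> \<le> t powr \<alpha>" if "0 \<le> t" "t \<le> s" for t
  proof -
    have "t / s \<le> (t / s) powr \<alpha>"
    proof (cases "t = 0")
      case False
      then have "(t / s) powr 1 \<le> (t / s) powr \<alpha>"
        using that s assms by (intro powr_mono') auto
      then show ?thesis using that s by simp
    qed simp
    then have "t / s * s powr \<alpha> \<le> (t / s) powr \<alpha> * s powr \<alpha>" by (intro mult_right_mono) auto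
    also have "\<dots> = t powr \<alpha>" using that s by (subst powr_mult[symmetric]) auto
    finally show ?thesis .
  qed
  have "s powr \<alpha> = u / s * s powr \<alpha> + v / s * s powr \<alpha>"
    using s by (simp add: s_def add_divide_distrib[symmetric] distrib_right[symmetric])
  also have "\<dots> \<le> u powr \<alpha> + v powr \<alpha>"
    using assms by (intro add_mono *) (auto simp: s_def)
  finally show ?thesis by (simp add: s_def)
qed simp

lemma powr_modulus:
  fixes c :: real
  assumes "0 < e" "0 < \<alpha>" "0 \<le> c"
  obtains d where "0 < d" "\<And>t. 0 \<le> t \<Longrightarrow> t < d \<Longrightarrow> c * t powr \<alpha> \<le> e"
proof
  define d where "d = (e / (c + 1)) powr (1 / \<alpha>)"
  show "0 < d" using assms by (simp add: d_def)
  show "c * t powr \<alpha> \<le> e" if "0 \<le> t" "t < d" for t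
  proof -
    have "t powr \<alpha> \<le> d powr \<alpha>" using that assms by (intro powr_mono2) auto
    also have "\<dots> = e / (c + 1)" using assms by (simp add: d_def powr_powr)
    finally have "c * t powr \<alpha> \<le> c * (e / (c + 1))" using assms by (intro mult_left_mono)
    also have "\<dots> \<le> e" using assms by (simp add: field_simps)
    finally show ?thesis .
  qed
qed

text \<open>Bounds the change of a Hoelder function with values in \<open>[0, 1]\<close> when one coordinate moves by
  \<open>t\<close>; the cap makes expectations finite without moment assumptions.\<close>

definition cost :: "real \<Rightarrow> real \<Rightarrow> real \<Rightarrow> real" where
  "cost \<alpha> c t = min 1 (c * \<bar>t\<bar> powr \<alpha>)"

lemma cost_measurable [measurable]: "cost \<alpha> c \<in> borel_measurable borel"
  unfolding cost_def by measurable

lemma cost_range: "0 \<le> c \<Longrightarrow> 0 \<le> cost \<alpha> c t \<and> cost \<alpha> c t \<le> 1"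
  by (auto simp: cost_def)

lemma cost_mono: "0 \<le> c \<Longrightarrow> c \<le> c' \<Longrightarrow> cost \<alpha> c t \<le> cost \<alpha> c' t"
  using mult_right_mono[of c c' "\<bar>t\<bar> powr \<alpha>"] unfolding cost_def by (intro min.mono) auto

lemma cost_diff:
  assumes "0 \<le> c" "0 < \<alpha>" "\<alpha> \<le> 1"
  shows "\<bar>cost \<alpha> c s - cost \<alpha> c t\<bar> \<le> c * \<bar>s - t\<bar> powr \<alpha>"
proof -
  have *: "\<bar>s\<bar> powr \<alpha> \<le> \<bar>t\<bar> powr \<alpha> + \<bar>s - t\<bar> powr \<alpha>" for s t :: real
  proof -
    have "\<bar>s\<bar> powr \<alpha> \<le> (\<bar>t\<bar> + \<bar>s - t\<bar>) powr \<alpha>"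
      using assms by (intro powr_mono2) auto
    also have "\<dots> \<le> \<bar>t\<bar> powr \<alpha> + \<bar>s - t\<bar> powr \<alpha>"
      using assms by (intro powr_subadditive) auto
    finally show ?thesis .
  qed
  have "c * \<bar>s\<bar> powr \<alpha> \<le> c * \<bar>t\<bar> powr \<alpha> + c * \<bar>s - t\<bar> powr \<alpha>"
    "c * \<bar>t\<bar> powr \<alpha> \<le> c * \<bar>s\<bar> powr \<alpha> + c * \<bar>s - t\<bar> powr \<alpha>"
    using mult_left_mono[OF *[of s t] assms(1)] mult_left_mono[OF *[of t s] assms(1)]
    by (simp_all add: distrib_left abs_minus_commute)
  moreover have "0 \<le> c * \<bar>s - t\<bar> powr \<alpha>" using assms by simp
  ultimately show ?thesis unfolding cost_def by linarith
qed

lemma cost_tendsto_zero: "(\<lambda>k. cost \<alpha> (inverse (real (Suc k))) t) \<longlonglongrightarrow> 0"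
proof -
  have "(\<lambda>k. min 1 (inverse (real (Suc k)) * \<bar>t\<bar> powr \<alpha>)) \<longlonglongrightarrow> min 1 (0 * \<bar>t\<bar> powr \<alpha>)"
    by (intro tendsto_intros LIMSEQ_inverse_real_of_nat)
  then show ?thesis by (simp add: cost_def)
qed

context stable_convergence
begin

definition mean_cost :: "real \<Rightarrow> real \<Rightarrow> nat \<Rightarrow> real" where
  "mean_cost \<alpha> c n = (\<integral>\<omega>. \<integral>y. cost \<alpha> c (X n \<omega> - y) \<partial>meas (\<mu> \<omega>) \<partial>P)"

lemma cost_X_measurable [measurable]:
  "(\<lambda>(\<omega>, y). cost \<alpha> c (X n \<omega> - y)) \<in> borel_measurable (P \<Otimes>\<^sub>M borel)"
  by measurable

lemma mean_cost_mono:
  assumes "0 \<le> c" "c \<le> c'"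
  shows "mean_cost \<alpha> c n \<le> mean_cost \<alpha> c' n"
proof -
  have abs1: "\<bar>cost \<alpha> c t\<bar> \<le> 1" "\<bar>cost \<alpha> c' t\<bar> \<le> 1" for t
    using cost_range[of c \<alpha> t] cost_range[of c' \<alpha> t] assms by auto
  show ?thesis
    unfolding mean_cost_def
    by (intro integral_mono integrable_average[where B=1] integrable_meas_bounded[where B=1]
        cost_X_measurable abs1 cost_mono assms) measurable
qed

lemma mean_cost_range:
  assumes "0 \<le> c"
  shows "0 \<le> mean_cost \<alpha> c n" "mean_cost \<alpha> c n \<le> 1"
proof -
  have abs1: "\<bar>cost \<alpha> c t\<bar> \<le> 1" for t using cost_range[of c \<alpha> t] assms by auto
  show "0 \<le> mean_cost \<alpha> c n" unfolding mean_cost_def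
    by (intro integral_nonneg_AE AE_I2) (use cost_range assms in auto)
  have "mean_cost \<alpha> c n \<le> (\<integral>\<omega>. 1 \<partial>P)"
    unfolding mean_cost_def
    by (intro integral_mono integrable_average[where B=1] cost_X_measurable abs1 integrable_const
        abs_le_D1[OF abs_integral_meas_le[OF _ abs1]]) measurable
  then show "mean_cost \<alpha> c n \<le> 1" by (simp add: prob_space)
qed

text \<open>Uniformity in \<open>n\<close> comes from stable convergence: for one small \<open>c\<close> the limit over \<open>n\<close> is
  small, hence so are all but finitely many terms, and the remaining ones are made small by decreasing
  \<open>c\<close> further.\<close>

lemma mean_cost_uniformly_small:
  assumes \<alpha>: "0 < \<alpha>" "\<alpha> \<le> 1" and e: "0 < e"
  obtains c where "0 < c" "\<And>n. mean_cost \<alpha> c n \<le> e"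
proof -
  let ?c = "\<lambda>k. inverse (real (Suc k))"
  \<comment> \<open>The mean cost is \<open>E \<phi>(\<omega>, X\<^sub>n)\<close>; its limit replaces \<open>X\<^sub>n\<close> by a second, independent draw from \<open>\<mu>(\<omega>)\<close>.\<close>
  define \<phi> where "\<phi> c \<omega> x = (\<integral>y. cost \<alpha> c (x - y) \<partial>meas (\<mu> \<omega>))" for c \<omega> x
  have \<phi>_meas: "(\<lambda>(\<omega>, x). \<phi> c \<omega> x) \<in> borel_measurable (P \<Otimes>\<^sub>M borel)" for c
    unfolding \<phi>_def split_beta by (intro measurable_integral_meas) measurable
  have abs1: "\<bar>cost \<alpha> c t\<bar> \<le> 1" if "0 \<le> c" for c t using cost_range[of c \<alpha> t] that by auto
  have \<phi>_range: "0 \<le> \<phi> c \<omega> x \<and> \<phi> c \<omega> x \<le> 1" if "0 \<le> c" for c \<omega> x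
    unfolding \<phi>_def
    by (intro conjI integral_nonneg_AE AE_I2 abs_le_D1[OF abs_integral_meas_le[OF _ abs1]] that)
      (use cost_range that in auto)
  have int_cost: "integrable (meas \<nu>) (\<lambda>y. cost \<alpha> c (x - y))" if "0 \<le> c" for c x \<nu>
    by (intro integrable_meas_bounded[where B=1] abs1 that) measurable
  have conv: "(\<lambda>n. mean_cost \<alpha> c n) \<longlonglongrightarrow> (\<integral>\<omega>. \<integral>x. \<phi> c \<omega> x \<partial>meas (\<mu> \<omega>) \<partial>P)" if c: "0 \<le> c" for c
    unfolding mean_cost_def \<phi>_def[symmetric]
  proof (rule stable_Caratheodory[OF \<phi>_meas \<phi>_range[OF c]])
    fix r :: real assume "0 < r"
    then obtain d where d: "0 < d" "\<And>t. 0 \<le> t \<Longrightarrow> t < d \<Longrightarrow> c * t powr \<alpha> \<le> r"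
      using powr_modulus \<alpha>(1) c by metis
    have "\<bar>\<phi> c \<omega> x - \<phi> c \<omega> x'\<bar> \<le> r" if "\<bar>x - x'\<bar> < d" for \<omega> x x'
    proof -
      have "\<phi> c \<omega> x - \<phi> c \<omega> x' = (\<integral>y. cost \<alpha> c (x - y) - cost \<alpha> c (x' - y) \<partial>meas (\<mu> \<omega>))"
        unfolding \<phi>_def using int_cost c by (subst Bochner_Integration.integral_diff) auto
      also have "\<bar>\<dots>\<bar> \<le> c * \<bar>x - x'\<bar> powr \<alpha>"
      proof (rule abs_integral_meas_le)
        show "\<bar>cost \<alpha> c (x - y) - cost \<alpha> c (x' - y)\<bar> \<le> c * \<bar>x - x'\<bar> powr \<alpha>" for y
          using cost_diff[OF c \<alpha>, of "x - y" "x' - y"] by simp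
      qed measurable
      also have "\<dots> \<le> r" using d(2)[of "\<bar>x - x'\<bar>"] that by simp
      finally show ?thesis .
    qed
    then show "\<exists>d>0. \<forall>\<omega>\<in>space P. \<forall>y y'. \<bar>y - y'\<bar> < d \<longrightarrow> \<bar>\<phi> c \<omega> y - \<phi> c \<omega> y'\<bar> \<le> r"
      using d(1) by blast
  qed
  have \<phi>_lim: "(\<lambda>k. \<phi> (?c k) \<omega> x) \<longlonglongrightarrow> 0" for \<omega> x
  proof -
    have "(\<lambda>k. \<phi> (?c k) \<omega> x) \<longlonglongrightarrow> (\<integral>y. 0 \<partial>meas (\<mu> \<omega>))"
      unfolding \<phi>_def
    proof (rule integral_dominated_convergence[where w="\<lambda>_. 1"])
      show "AE y in meas (\<mu> \<omega>). norm (cost \<alpha> (?c k) (x - y)) \<le> 1" for k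
        using abs1[of "?c k"] by simp
    qed (use cost_tendsto_zero in \<open>auto intro!: integrable_meas_bounded[where B=1]\<close>)
    then show ?thesis by simp
  qed
  have "(\<lambda>k. \<integral>\<omega>. \<integral>x. \<phi> (?c k) \<omega> x \<partial>meas (\<mu> \<omega>) \<partial>P) \<longlonglongrightarrow> 0"
    by (rule average_tendsto_zero[OF \<phi>_meas _ \<phi>_lim]) (simp add: \<phi>_range)
  then have "\<forall>\<^sub>F k in sequentially. (\<integral>\<omega>. \<integral>x. \<phi> (?c k) \<omega> x \<partial>meas (\<mu> \<omega>) \<partial>P) < e"
    using e by (intro order_tendstoD(2)) auto
  then obtain k where "(\<integral>\<omega>. \<integral>x. \<phi> (?c k) \<omega> x \<partial>meas (\<mu> \<omega>) \<partial>P) < e"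
    by (auto simp: eventually_sequentially)
  then have "\<forall>\<^sub>F n in sequentially. mean_cost \<alpha> (?c k) n < e"
    by (intro order_tendstoD(2)[OF conv]) auto
  then obtain n0 where n0: "\<And>n. n \<ge> n0 \<Longrightarrow> mean_cost \<alpha> (?c k) n < e"
    by (auto simp: eventually_sequentially)
  have "(\<lambda>m. mean_cost \<alpha> (?c m) n) \<longlonglongrightarrow> 0" for n
    unfolding mean_cost_def
    by (rule average_tendsto_zero[OF cost_X_measurable _ cost_tendsto_zero]) (simp add: cost_range)
  then have "\<forall>\<^sub>F m in sequentially. \<forall>n\<in>{..<n0}. mean_cost \<alpha> (?c m) n < e"
    using e by (intro eventually_ball_finite ballI order_tendstoD(2)) auto
  then obtain m where m: "\<And>n. n < n0 \<Longrightarrow> mean_cost \<alpha> (?c m) n < e"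
    by (auto simp: eventually_sequentially)
  show thesis
  proof (rule that[of "min (?c k) (?c m)"])
    fix n
    show "mean_cost \<alpha> (min (?c k) (?c m)) n \<le> e"
      using n0[of n] m[of n] mean_cost_mono[of "min (?c k) (?c m)" "?c k" \<alpha> n]
        mean_cost_mono[of "min (?c k) (?c m)" "?c m" \<alpha> n] by (cases "n < n0") auto
  qed auto
qed

end

section \<open>Averaging coordinates\<close>

abbreviation seq_borel :: "(nat \<Rightarrow> real) measure" where
  "seq_borel \<equiv> Pi\<^sub>M UNIV (\<lambda>_. borel)"

text \<open>Exchanging the variable in position \<open>i\<close> for a fresh draw from \<open>\<nu>\<close>.\<close>

definition coord_avg ::
  "nat \<Rightarrow> ((nat \<Rightarrow> real) \<Rightarrow> borel_prob \<Rightarrow> real) \<Rightarrow> (nat \<Rightarrow> real) \<Rightarrow> borel_prob \<Rightarrow> real" where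
  "coord_avg i F x \<nu> = (\<integral>y. F (x(i := y)) \<nu> \<partial>meas \<nu>)"

text \<open>The Hoelder bound is imposed for one coordinate at a time and at fixed \<open>\<nu>\<close> because in this
  form it survives averaging with the same constant. A modulus of continuity in \<open>\<nu>\<close> would not: the
  averages are taken against \<open>\<nu>\<close>, so their dependence on \<open>\<nu>\<close> degrades with each coordinate.\<close>

definition test_fn ::
  "borel_prob set \<Rightarrow> nat set \<Rightarrow> real \<Rightarrow> real \<Rightarrow> ((nat \<Rightarrow> real) \<Rightarrow> borel_prob \<Rightarrow> real) \<Rightarrow> bool" where
  "test_fn S I \<alpha> c F \<longleftrightarrow>
     (\<lambda>(x, \<nu>). F x \<nu>) \<in> borel_measurable (seq_borel \<Otimes>\<^sub>M borel) \<and>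
     (\<forall>x \<nu>. 0 \<le> F x \<nu> \<and> F x \<nu> \<le> 1) \<and>
     (\<forall>x x' \<nu>. (\<forall>i\<in>I. x i = x' i) \<longrightarrow> F x \<nu> = F x' \<nu>) \<and>
     (\<forall>x i y y'. \<forall>\<nu>\<in>S. \<bar>F (x(i := y)) \<nu> - F (x(i := y')) \<nu>\<bar> \<le> c * \<bar>y - y'\<bar> powr \<alpha>)"

lemma measurable_to_seq_borel:
  assumes "\<And>i. (\<lambda>\<omega>. x \<omega> i) \<in> borel_measurable M"
  shows "x \<in> M \<rightarrow>\<^sub>M seq_borel"
  using measurable_PiM_single'[of UNIV "\<lambda>i \<omega>. x \<omega> i" M "\<lambda>_. borel"] assms by auto

lemma test_fn_measurable:
  assumes F: "test_fn S I \<alpha> c F" and x: "\<And>i. (\<lambda>\<omega>. x \<omega> i) \<in> borel_measurable M"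
    and m: "m \<in> borel_measurable M"
  shows "(\<lambda>\<omega>. F (x \<omega>) (m \<omega>)) \<in> borel_measurable M"
proof -
  have "(\<lambda>(x, \<nu>). F x \<nu>) \<in> borel_measurable (seq_borel \<Otimes>\<^sub>M borel)"
    using F by (simp add: test_fn_def)
  from measurable_compose[OF measurable_Pair[OF measurable_to_seq_borel[OF x] m] this]
  show ?thesis by simp
qed

lemma test_fn_update_measurable:
  assumes F: "test_fn S I \<alpha> c F" and x: "\<And>i. (\<lambda>\<omega>. x \<omega> i) \<in> borel_measurable M"
    and m: "m \<in> borel_measurable M"
  shows "(\<lambda>(\<omega>, y). F ((x \<omega>)(i := y)) (m \<omega>)) \<in> borel_measurable (M \<Otimes>\<^sub>M borel)"
  unfolding split_beta
proof (rule test_fn_measurable[OF F])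
  show "(\<lambda>w. ((x (fst w))(i := snd w)) j) \<in> borel_measurable (M \<Otimes>\<^sub>M borel)" for j
    using measurable_compose[OF measurable_fst x] by (cases "j = i") auto
  show "(\<lambda>w. m (fst w)) \<in> borel_measurable (M \<Otimes>\<^sub>M borel)"
    using measurable_compose[OF measurable_fst m] .
qed

lemma test_fn_section:
  assumes "test_fn S I \<alpha> c F"
  shows "(\<lambda>y. F (x(i := y)) \<nu>) \<in> borel_measurable borel"
  by (rule test_fn_measurable[OF assms]) auto

lemma test_fn_abs: "test_fn S I \<alpha> c F \<Longrightarrow> \<bar>F x \<nu>\<bar> \<le> 1"
  by (simp add: test_fn_def)

lemma test_fn_range: "test_fn S I \<alpha> c F \<Longrightarrow> 0 \<le> F x \<nu> \<and> F x \<nu> \<le> 1"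
  by (simp add: test_fn_def)

lemma test_fn_cong: "test_fn S I \<alpha> c F \<Longrightarrow> (\<And>i. i \<in> I \<Longrightarrow> x i = x' i) \<Longrightarrow> F x \<nu> = F x' \<nu>"
  by (simp add: test_fn_def)

lemma test_fn_Hoelder:
  "test_fn S I \<alpha> c F \<Longrightarrow> \<nu> \<in> S \<Longrightarrow> \<bar>F (x(i := y)) \<nu> - F (x(i := y')) \<nu>\<bar> \<le> c * \<bar>y - y'\<bar> powr \<alpha>"
  by (simp add: test_fn_def)

lemma test_fn_integrable:
  "test_fn S I \<alpha> c F \<Longrightarrow> integrable (meas \<nu>) (\<lambda>y. F (x(i := y)) \<nu>)"
  by (intro integrable_meas_bounded[where B=1] test_fn_section test_fn_abs)

lemma test_fn_coord_avg:
  assumes F: "test_fn S I \<alpha> c F"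
  shows "test_fn S (I - {i}) \<alpha> c (coord_avg i F)"
proof -
  have "(\<lambda>z. \<integral>y. F ((fst z)(i := y)) (snd z) \<partial>meas (snd z)) \<in> borel_measurable (seq_borel \<Otimes>\<^sub>M borel)"
    using test_fn_update_measurable[OF F, of fst "seq_borel \<Otimes>\<^sub>M borel" snd i]
    by (intro measurable_integral_meas) (auto intro!: measurable_compose[OF measurable_fst])
  then have "(\<lambda>(x, \<nu>). coord_avg i F x \<nu>) \<in> borel_measurable (seq_borel \<Otimes>\<^sub>M borel)"
    by (simp add: coord_avg_def split_beta)
  moreover have "0 \<le> coord_avg i F x \<nu> \<and> coord_avg i F x \<nu> \<le> 1" for x \<nu>
    unfolding coord_avg_def using test_fn_range[OF F]
    by (auto intro!: abs_le_D1[OF abs_integral_meas_le] test_fn_section[OF F])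
  moreover have "coord_avg i F x \<nu> = coord_avg i F x' \<nu>" if "\<forall>j\<in>I - {i}. x j = x' j" for x x' \<nu>
    unfolding coord_avg_def using that
    by (intro Bochner_Integration.integral_cong refl test_fn_cong[OF F]) auto
  moreover have "\<bar>coord_avg i F (x(j := y)) \<nu> - coord_avg i F (x(j := y')) \<nu>\<bar> \<le> c * \<bar>y - y'\<bar> powr \<alpha>"
    if \<nu>: "\<nu> \<in> S" for x j y y' \<nu>
  proof -
    have "coord_avg i F (x(j := y)) \<nu> - coord_avg i F (x(j := y')) \<nu> =
        (\<integral>z. F (x(j := y, i := z)) \<nu> - F (x(j := y', i := z)) \<nu> \<partial>meas \<nu>)"
      unfolding coord_avg_def
      by (intro Bochner_Integration.integral_diff[symmetric] test_fn_integrable[OF F])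
    also have "\<bar>\<dots>\<bar> \<le> c * \<bar>y - y'\<bar> powr \<alpha>"
    proof (rule abs_integral_meas_le)
      show "(\<lambda>z. F (x(j := y, i := z)) \<nu> - F (x(j := y', i := z)) \<nu>) \<in> borel_measurable borel"
        by (intro borel_measurable_diff test_fn_section[OF F])
      have c: "0 \<le> c * \<bar>y - y'\<bar> powr \<alpha>"
        using order_trans[OF abs_ge_zero test_fn_Hoelder[OF F \<nu>]] .
      show "\<bar>F (x(j := y, i := z)) \<nu> - F (x(j := y', i := z)) \<nu>\<bar> \<le> c * \<bar>y - y'\<bar> powr \<alpha>" for z
      proof (cases "j = i")
        case False
        then show ?thesis
          using test_fn_Hoelder[OF F \<nu>, of "x(i := z)" j y y'] by (simp add: fun_upd_twist)
      qed (simp add: c)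
    qed
    finally show ?thesis .
  qed
  ultimately show ?thesis unfolding test_fn_def by blast
qed

lemma test_fn_foldr_coord_avg:
  "test_fn S I \<alpha> c F \<Longrightarrow> test_fn S (I - set is) \<alpha> c (foldr coord_avg is F)"
proof (induction "is")
  case (Cons i "is")
  have "I - set (i # is) = I - set is - {i}" by auto
  with test_fn_coord_avg[OF Cons.IH[OF Cons.prems], of i] show ?case by simp
qed simp

lemma coord_avg_error:
  assumes F: "test_fn S I \<alpha> c F" and \<nu>: "\<nu> \<in> S" and c: "0 \<le> c"
  shows "\<bar>F x \<nu> - coord_avg i F x \<nu>\<bar> \<le> (\<integral>y. cost \<alpha> c (x i - y) \<partial>meas \<nu>)"
proof -
  have c1: "\<bar>cost \<alpha> c t\<bar> \<le> 1" for t using cost_range[of c \<alpha> t] c by auto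
  have "F x \<nu> - coord_avg i F x \<nu> = (\<integral>y. F x \<nu> - F (x(i := y)) \<nu> \<partial>meas \<nu>)"
    unfolding coord_avg_def using test_fn_integrable[OF F] prob_space.finite_measure[OF prob_space_meas]
    by (subst Bochner_Integration.integral_diff) (auto intro!: finite_measure.integrable_const)
  also have "\<bar>\<dots>\<bar> \<le> (\<integral>y. \<bar>F x \<nu> - F (x(i := y)) \<nu>\<bar> \<partial>meas \<nu>)" by (rule integral_abs_bound)
  also have "\<dots> \<le> (\<integral>y. cost \<alpha> c (x i - y) \<partial>meas \<nu>)"
  proof (rule integral_mono)
    show "integrable (meas \<nu>) (\<lambda>y. \<bar>F x \<nu> - F (x(i := y)) \<nu>\<bar>)"
      using test_fn_integrable[OF F] prob_space.finite_measure[OF prob_space_meas]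
      by (intro integrable_abs Bochner_Integration.integrable_diff finite_measure.integrable_const)
    show "integrable (meas \<nu>) (\<lambda>y. cost \<alpha> c (x i - y))"
      by (intro integrable_meas_bounded[where B=1] c1) measurable
    show "\<bar>F x \<nu> - F (x(i := y)) \<nu>\<bar> \<le> cost \<alpha> c (x i - y)" for y
      using test_fn_Hoelder[OF F \<nu>, of x i "x i" y] test_fn_range[OF F, of x \<nu>]
        test_fn_range[OF F, of "x(i := y)" \<nu>]
      by (auto simp: cost_def)
  qed
  finally show ?thesis .
qed

lemma measurable_override:
  "(\<lambda>u j. if j \<in> J then u j else x j) \<in> Pi\<^sub>M J (\<lambda>_. meas \<nu>) \<rightarrow>\<^sub>M seq_borel"
proof (rule measurable_to_seq_borel)
  fix j
  have "(\<lambda>u. u j) \<in> borel_measurable (Pi\<^sub>M J (\<lambda>_. meas \<nu>))" if "j \<in> J"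
    using measurable_component_singleton[OF that, of "\<lambda>_. meas \<nu>"]
    by (simp cong: measurable_cong_sets)
  then show "(\<lambda>u. if j \<in> J then u j else x j) \<in> borel_measurable (Pi\<^sub>M J (\<lambda>_. meas \<nu>))"
    by (cases "j \<in> J") auto
qed

lemma product_prob_space_meas: "product_prob_space (\<lambda>_. meas \<nu>)"
  by (intro product_prob_spaceI prob_space_meas)

text \<open>The induction peels off the coordinate averaged first, which is the innermost integral;
  peeling off the outermost one instead would call for an interchange of integrals.\<close>

lemma foldr_coord_avg_eq_integral:
  assumes "test_fn S I \<alpha> c F" "distinct is"
  shows "foldr coord_avg is F x \<nu> =
    (\<integral>u. F (\<lambda>j. if j \<in> set is then u j else x j) \<nu> \<partial>Pi\<^sub>M (set is) (\<lambda>_. meas \<nu>))"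
  using assms
proof (induction "is" arbitrary: F I rule: rev_induct)
  case Nil
  interpret product_prob_space "\<lambda>_. meas \<nu>" by (rule product_prob_space_meas)
  show ?case by (simp add: PiM_empty lebesgue_integral_count_space_finite)
next
  case (snoc i "is")
  interpret product_prob_space "\<lambda>_. meas \<nu>" by (rule product_prob_space_meas)
  let ?J = "set is"
  let ?f = "\<lambda>u. F (\<lambda>j. if j \<in> insert i ?J then u j else x j) \<nu>"
  have i: "i \<notin> ?J" "distinct is" using snoc.prems by auto
  interpret fin: prob_space "Pi\<^sub>M (insert i ?J) (\<lambda>_. meas \<nu>)"
    by (intro prob_space_PiM prob_space_meas)
  have "?f \<in> borel_measurable (Pi\<^sub>M (insert i ?J) (\<lambda>_. meas \<nu>))"
    by (rule test_fn_measurable[OF snoc.prems(1)])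
      (rule measurable_compose[OF measurable_override measurable_component_singleton], auto)
  then have int: "integrable (Pi\<^sub>M (insert i ?J) (\<lambda>_. meas \<nu>)) ?f"
    by (intro fin.integrable_const_bound[where B=1]) (auto simp: test_fn_abs[OF snoc.prems(1)])
  have "foldr coord_avg (is @ [i]) F x \<nu> = foldr coord_avg is (coord_avg i F) x \<nu>" by simp
  also have "\<dots> = (\<integral>u. coord_avg i F (\<lambda>j. if j \<in> ?J then u j else x j) \<nu> \<partial>Pi\<^sub>M ?J (\<lambda>_. meas \<nu>))"
    using i by (intro snoc.IH[OF test_fn_coord_avg[OF snoc.prems(1)]])
  also have "\<dots> = (\<integral>u. (\<integral>y. ?f (u(i := y)) \<partial>meas \<nu>) \<partial>Pi\<^sub>M ?J (\<lambda>_. meas \<nu>))"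
    unfolding coord_avg_def using i
    by (intro Bochner_Integration.integral_cong refl arg_cong[where f="\<lambda>z. F z \<nu>"]) auto
  also have "\<dots> = (\<integral>u. ?f u \<partial>Pi\<^sub>M (insert i ?J) (\<lambda>_. meas \<nu>))"
    using i by (intro product_integral_insert[symmetric] int) auto
  finally show ?case by simp
qed

lemma foldr_coord_avg_all:
  assumes F: "test_fn S I \<alpha> c F" and "is": "distinct is" "set is = I"
  shows "foldr coord_avg is F x \<nu> = (\<integral>u. F u \<nu> \<partial>Pi\<^sub>M UNIV (\<lambda>_. meas \<nu>))"
proof -
  have [simp]: "finite I" using "is"(2) by auto
  let ?f = "\<lambda>u. F (\<lambda>j. if j \<in> I then u j else x j) \<nu>"
  have meas: "?f \<in> borel_measurable (Pi\<^sub>M I (\<lambda>_. meas \<nu>))"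
    by (rule test_fn_measurable[OF F])
      (rule measurable_compose[OF measurable_override measurable_component_singleton], auto)
  have "foldr coord_avg is F x \<nu> = (\<integral>u. ?f u \<partial>Pi\<^sub>M I (\<lambda>_. meas \<nu>))"
    using foldr_coord_avg_eq_integral[OF F "is"(1)] "is"(2) by simp
  also have "\<dots> = (\<integral>u. ?f u \<partial>distr (Pi\<^sub>M UNIV (\<lambda>_. meas \<nu>)) (Pi\<^sub>M I (\<lambda>_. meas \<nu>)) (\<lambda>u. restrict u I))"
    by (subst product_prob_space.distr_PiM_restrict_finite[OF product_prob_space_meas]) auto
  also have "\<dots> = (\<integral>u. ?f (restrict u I) \<partial>Pi\<^sub>M UNIV (\<lambda>_. meas \<nu>))"
    by (intro integral_distr meas measurable_restrict_subset) auto
  also have "\<dots> = (\<integral>u. F u \<nu> \<partial>Pi\<^sub>M UNIV (\<lambda>_. meas \<nu>))"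
    by (intro Bochner_Integration.integral_cong refl test_fn_cong[OF F]) auto
  finally show ?thesis .
qed

context stable_convergence
begin

text \<open>The single swap with the earlier variables \<open>x\<close> held fixed: as a function of \<open>\<omega>\<close> and the value put
  in position \<open>i\<close>, the test function is equicontinuous in the latter.\<close>

lemma swap_tendsto:
  assumes F: "test_fn S I \<alpha> c F" and c: "0 \<le> c" and \<alpha>: "0 < \<alpha>"
    and S: "\<And>\<omega>. \<mu> \<omega> \<in> S"
    and x: "\<And>j. (\<lambda>\<omega>. x \<omega> j) \<in> borel_measurable P"
  shows "(\<lambda>n. \<integral>\<omega>. F ((x \<omega>)(i := X n \<omega>)) (\<mu> \<omega>) \<partial>P)
    \<longlonglongrightarrow> (\<integral>\<omega>. coord_avg i F (x \<omega>) (\<mu> \<omega>) \<partial>P)"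
  unfolding coord_avg_def
proof (rule stable_Caratheodory)
  show "(\<lambda>(\<omega>, y). F ((x \<omega>)(i := y)) (\<mu> \<omega>)) \<in> borel_measurable (P \<Otimes>\<^sub>M borel)"
    by (intro test_fn_update_measurable[OF F] x \<mu>_measurable)
  fix e :: real assume "0 < e"
  then obtain d where d: "0 < d" "\<And>t. 0 \<le> t \<Longrightarrow> t < d \<Longrightarrow> c * t powr \<alpha> \<le> e"
    using powr_modulus \<alpha> c by metis
  show "\<exists>d>0. \<forall>\<omega>\<in>space P. \<forall>y y'. \<bar>y - y'\<bar> < d \<longrightarrow>
      \<bar>F ((x \<omega>)(i := y)) (\<mu> \<omega>) - F ((x \<omega>)(i := y')) (\<mu> \<omega>)\<bar> \<le> e"
  proof (intro exI[of _ d] conjI ballI allI impI d(1))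
    fix \<omega> and y y' :: real assume "\<bar>y - y'\<bar> < d"
    then have "c * \<bar>y - y'\<bar> powr \<alpha> \<le> e" by (intro d(2)) auto
    with test_fn_Hoelder[OF F S]
    show "\<bar>F ((x \<omega>)(i := y)) (\<mu> \<omega>) - F ((x \<omega>)(i := y')) (\<mu> \<omega>)\<bar> \<le> e"
      by (rule order_trans)
  qed
qed (use test_fn_range[OF F] in auto)

lemma test_fn_integrable_P:
  assumes F: "test_fn S I \<alpha> c F" and x: "\<And>j. (\<lambda>\<omega>. x \<omega> j) \<in> borel_measurable P"
  shows "integrable P (\<lambda>\<omega>. F (x \<omega>) (\<mu> \<omega>))"
  by (intro integrable_const_bound[where B=1] AE_I2 test_fn_measurable[OF F] x \<mu>_measurable)
    (simp add: test_fn_abs[OF F])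

text \<open>The crude bound for the same swap, valid for every \<open>n\<close> and however \<open>x\<close> depends on \<open>X n\<close>.\<close>

lemma swap_error:
  assumes F: "test_fn S I \<alpha> c F" and c: "0 \<le> c"
    and S: "\<And>\<omega>. \<mu> \<omega> \<in> S"
    and x: "\<And>j. (\<lambda>\<omega>. x \<omega> j) \<in> borel_measurable P" and xi: "\<And>\<omega>. x \<omega> i = X n \<omega>"
  shows "\<bar>(\<integral>\<omega>. F (x \<omega>) (\<mu> \<omega>) \<partial>P) - (\<integral>\<omega>. coord_avg i F (x \<omega>) (\<mu> \<omega>) \<partial>P)\<bar> \<le> mean_cost \<alpha> c n"
proof -
  have c1: "\<bar>cost \<alpha> c t\<bar> \<le> 1" for t using cost_range[of c \<alpha> t] c by auto
  note ints = test_fn_integrable_P[OF F x] test_fn_integrable_P[OF test_fn_coord_avg[OF F] x]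
  have "\<bar>(\<integral>\<omega>. F (x \<omega>) (\<mu> \<omega>) \<partial>P) - (\<integral>\<omega>. coord_avg i F (x \<omega>) (\<mu> \<omega>) \<partial>P)\<bar>
      = \<bar>\<integral>\<omega>. F (x \<omega>) (\<mu> \<omega>) - coord_avg i F (x \<omega>) (\<mu> \<omega>) \<partial>P\<bar>"
    using ints by (subst Bochner_Integration.integral_diff) auto
  also have "\<dots> \<le> (\<integral>\<omega>. \<bar>F (x \<omega>) (\<mu> \<omega>) - coord_avg i F (x \<omega>) (\<mu> \<omega>)\<bar> \<partial>P)"
    by (rule integral_abs_bound)
  also have "\<dots> \<le> mean_cost \<alpha> c n"
    unfolding mean_cost_def
  proof (rule integral_mono)
    show "integrable P (\<lambda>\<omega>. \<integral>y. cost \<alpha> c (X n \<omega> - y) \<partial>meas (\<mu> \<omega>))"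
      by (intro integrable_average[where B=1] cost_X_measurable c1)
    show "\<bar>F (x \<omega>) (\<mu> \<omega>) - coord_avg i F (x \<omega>) (\<mu> \<omega>)\<bar> \<le> (\<integral>y. cost \<alpha> c (X n \<omega> - y) \<partial>meas (\<mu> \<omega>))"
      for \<omega> using coord_avg_error[OF F S c, of "x \<omega>" \<omega> i] by (simp add: xi)
  qed (use ints in auto)
  finally show ?thesis .
qed

end

section \<open>Choosing the subsequence\<close>

lemma exists_slow_divergence:
  fixes e :: "nat \<Rightarrow> real"
  assumes "\<And>k. 0 \<le> e k" "e \<longlonglongrightarrow> 0"
  obtains N :: "nat \<Rightarrow> nat" where "filterlim N at_top sequentially" "(\<lambda>k. real (N k) * e k) \<longlonglongrightarrow> 0"
proof
  \<comment> \<open>The summand \<open>1/(k+1)\<close> keeps \<open>b\<close> positive where \<open>e\<close> vanishes; then \<open>N \<approx> 1 / sqrt b\<close> gives \<open>N e \<le> sqrt b\<close>.\<close>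
  define b where "b k = e k + inverse (real (Suc k))" for k
  define N where "N k = nat \<lfloor>1 / sqrt (b k)\<rfloor>" for k
  have b: "0 < b k" for k using assms(1)[of k] by (simp add: b_def add_nonneg_pos)
  have "b \<longlonglongrightarrow> 0 + 0"
    unfolding b_def by (intro tendsto_add assms(2) LIMSEQ_inverse_real_of_nat)
  from tendsto_real_sqrt[OF this] have sqrt_b: "(\<lambda>k. sqrt (b k)) \<longlonglongrightarrow> 0" by simp
  show "filterlim N at_top sequentially"
    unfolding filterlim_at_top
  proof
    fix Z
    have "\<forall>\<^sub>F k in sequentially. sqrt (b k) < 1 / (real Z + 1)"
      by (rule order_tendstoD(2)[OF sqrt_b]) simp
    then show "\<forall>\<^sub>F k in sequentially. Z \<le> N k"
    proof eventually_elim
      case (elim k)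
      then have "real Z + 1 < 1 / sqrt (b k)" using b[of k] by (simp add: field_simps)
      then show ?case unfolding N_def by linarith
    qed
  qed
  show "(\<lambda>k. real (N k) * e k) \<longlonglongrightarrow> 0"
  proof (rule tendsto_sandwich[OF _ _ tendsto_const sqrt_b])
    show "\<forall>\<^sub>F k in sequentially. 0 \<le> real (N k) * e k" using assms(1) by simp
    show "\<forall>\<^sub>F k in sequentially. real (N k) * e k \<le> sqrt (b k)"
    proof (intro always_eventually allI)
      fix k
      have "real (N k) \<le> 1 / sqrt (b k)" using b[of k] unfolding N_def by simp
      moreover have "e k \<le> b k" by (simp add: b_def)
      ultimately have "real (N k) * e k \<le> 1 / sqrt (b k) * b k"
        using assms(1)[of k] b[of k] by (intro mult_mono) auto
      also have "\<dots> = sqrt (b k)" using b[of k] by (simp add: real_div_sqrt)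
      finally show "real (N k) * e k \<le> sqrt (b k)" .
    qed
  qed
qed

lemma sum_two_scale_bound:
  fixes e :: real
  assumes "0 \<le> e"
  shows "(\<Sum>j<M. if j < N then e else (1 / 2) ^ j) \<le> real N * e + 2 * (1 / 2) ^ N"
proof -
  have "(\<Sum>j<M. if j < N then e else (1 / 2) ^ j) \<le>
      (if M \<le> N then real M * e else real N * e + 2 * (1 / 2) ^ N - 2 * (1 / 2) ^ M)"
  proof (induction M)
    case (Suc M)
    consider "Suc M \<le> N" | "M = N" | "N < M" by linarith
    then show ?case using Suc by cases (auto simp: algebra_simps)
  qed simp
  also have "\<dots> \<le> real N * e + 2 * (1 / 2) ^ N"
    using assms by (auto intro!: add_increasing2 mult_right_mono)
  finally show ?thesis .
qed

context stable_convergence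
begin

lemma mean_cost_sup:
  assumes \<alpha>: "0 < \<alpha>" "\<alpha> \<le> 1" and c: "\<And>k. 0 \<le> c k" "c \<longlonglongrightarrow> 0"
  obtains e where "\<And>k. 0 \<le> e k" "e \<longlonglongrightarrow> 0" "\<And>k n. mean_cost \<alpha> (c k) n \<le> e k"
proof
  define e where "e k = (SUP n. mean_cost \<alpha> (c k) n)" for k
  have bdd: "bdd_above (range (mean_cost \<alpha> (c k)))" for k
    using mean_cost_range(2)[OF c(1)] by (intro bdd_aboveI) auto
  show le: "mean_cost \<alpha> (c k) n \<le> e k" for k n
    unfolding e_def by (rule cSUP_upper[OF _ bdd]) simp
  show nonneg: "0 \<le> e k" for k
    using mean_cost_range(1)[OF c(1)] le by (rule order_trans)
  show "e \<longlonglongrightarrow> 0"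
  proof (rule LIMSEQ_I)
    fix r :: real assume "0 < r"
    then obtain c0 where c0: "0 < c0" "\<And>n. mean_cost \<alpha> c0 n \<le> r / 2"
      using mean_cost_uniformly_small[OF \<alpha>, of "r / 2"] by auto
    have "\<forall>\<^sub>F k in sequentially. c k < c0"
      using c(2) c0(1) by (rule order_tendstoD(2))
    then have "\<forall>\<^sub>F k in sequentially. norm (e k - 0) < r"
    proof eventually_elim
      case (elim k)
      have "e k \<le> r / 2"
        unfolding e_def
        using order_trans[OF mean_cost_mono[OF c(1) less_imp_le[OF elim]] c0(2)]
        by (intro cSUP_least) auto
      with nonneg[of k] \<open>0 < r\<close> show ?case by simp
    qed
    then show "\<exists>no. \<forall>k\<ge>no. norm (e k - 0) < r" by (simp add: eventually_sequentially)
  qed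
qed

text \<open>The index \<open>l\<close> runs through countably many test functions, to be served by one subsequence;
  stage \<open>j\<close> takes care of those with \<open>l \<le> j\<close>. Stage \<open>j\<close> does not see a permutation \<open>\<pi>\<close> as a whole but only the
  list of positions already averaged (those holding an index above \<open>j\<close>), the position of \<open>j\<close>, and the
  placement \<open>\<sigma> = min j \<circ> \<pi>\<close> of the earlier indices, so finitely many swaps cover all permutations.\<close>

theorem swapping_subsequence:
  fixes \<Phi> :: "nat \<Rightarrow> nat \<Rightarrow> (nat \<Rightarrow> real) \<Rightarrow> borel_prob \<Rightarrow> real" and I :: "nat \<Rightarrow> nat set"
  assumes \<alpha>: "0 < \<alpha>" "\<alpha> \<le> 1"
    and S: "\<And>\<omega>. \<mu> \<omega> \<in> S"
    and fin: "\<And>k. finite (I k)"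
    and test: "\<And>l k. test_fn S (I k) \<alpha> (c l k) (\<Phi> l k)"
    and c: "\<And>l k. 0 \<le> c l k" "\<And>l. (\<lambda>k. c l k) \<longlonglongrightarrow> 0"
  shows "\<exists>r :: nat \<Rightarrow> nat. strict_mono r \<and> (\<forall>\<pi> l. bij \<pi> \<longrightarrow>
    (\<lambda>k. (\<integral>\<omega>. \<Phi> l k (\<lambda>i. X (r (\<pi> i)) \<omega>) (\<mu> \<omega>) \<partial>P) -
       (\<integral>\<omega>. \<integral>u. \<Phi> l k u (\<mu> \<omega>) \<partial>Pi\<^sub>M UNIV (\<lambda>_. meas (\<mu> \<omega>)) \<partial>P)) \<longlonglongrightarrow> 0)"
proof -
  have "\<exists>e N. (\<forall>k. 0 \<le> e k) \<and> (\<forall>k n. mean_cost \<alpha> (c l k) n \<le> e k) \<and>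
      filterlim N at_top sequentially \<and> (\<lambda>k. real (N k) * e k) \<longlonglongrightarrow> 0" for l
  proof -
    obtain e where e: "\<And>k. 0 \<le> e k" "e \<longlonglongrightarrow> 0" "\<And>k n. mean_cost \<alpha> (c l k) n \<le> e k"
      using mean_cost_sup[OF \<alpha> c] by blast
    obtain N where "filterlim N at_top sequentially" "(\<lambda>k. real (N k) * e k) \<longlonglongrightarrow> 0"
      using exists_slow_divergence[OF e(1,2)] by blast
    with e show ?thesis by blast
  qed
  then obtain e :: "nat \<Rightarrow> nat \<Rightarrow> real" and N :: "nat \<Rightarrow> nat \<Rightarrow> nat" where
    e_nonneg: "\<And>l k. 0 \<le> e l k" and e: "\<And>l k n. mean_cost \<alpha> (c l k) n \<le> e l k"
    and N: "\<And>l. filterlim (N l) at_top sequentially"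
    and Ne: "\<And>l. (\<lambda>k. real (N l k) * e l k) \<longlonglongrightarrow> 0"
    by metis
  \<comment> \<open>Positions not holding an earlier term get the dummy value \<open>0\<close>: they are already averaged out or about to be overwritten.\<close>
  define arg where "arg r j \<sigma> \<omega> = (\<lambda>i. if \<sigma> i < j then X (r (\<sigma> i)) \<omega> else 0)"
    for r :: "nat \<Rightarrow> nat" and j and \<sigma> :: "nat \<Rightarrow> nat" and \<omega>
  have arg_meas: "(\<lambda>\<omega>. arg r j \<sigma> \<omega> i) \<in> borel_measurable P" for r j \<sigma> i
    unfolding arg_def by (cases "\<sigma> i < j") auto
  define swap_ok where "swap_ok r j n l k is i \<sigma> \<longleftrightarrow>
      \<bar>(\<integral>\<omega>. foldr coord_avg is (\<Phi> l k) ((arg r j \<sigma> \<omega>)(i := X n \<omega>)) (\<mu> \<omega>) \<partial>P) -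
       (\<integral>\<omega>. coord_avg i (foldr coord_avg is (\<Phi> l k)) (arg r j \<sigma> \<omega>) (\<mu> \<omega>) \<partial>P)\<bar> < (1 / 2) ^ j"
    for r j n l k "is" i \<sigma>
  define lists where "lists k = {is. set is \<subseteq> I k \<and> length is \<le> card (I k)}" for k
  define swaps where "swaps j = (SIGMA l:{..j}. SIGMA k:{k. N l k \<le> j}.
      lists k \<times> I k \<times> PiE (I k) (\<lambda>_. {..j}))" for j :: nat
  \<comment> \<open>The requirements on \<open>n\<close> as the \<open>j\<close>-th index of the subsequence, given the earlier indices \<open>r\<close>.\<close>
  define Q where "Q r j n \<longleftrightarrow> (0 < j \<longrightarrow> r (j - 1) < n) \<and>
      (\<forall>(l, k, is, i, \<sigma>) \<in> swaps j. swap_ok r j n l k is i \<sigma>)" for r j n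
  have fin_swaps: "finite (swaps j)" for j
  proof -
    have "finite {k. N l k \<le> j}" for l
    proof -
      have "\<forall>\<^sub>F k in sequentially. Suc j \<le> N l k" using N by (simp add: filterlim_at_top)
      then obtain k0 where "\<And>k. k \<ge> k0 \<Longrightarrow> Suc j \<le> N l k" by (auto simp: eventually_sequentially)
      then have "{k. N l k \<le> j} \<subseteq> {..<k0}" by (force simp: not_le[symmetric])
      then show ?thesis by (rule finite_subset) simp
    qed
    then show ?thesis
      unfolding swaps_def lists_def using fin
      by (intro finite_SigmaI finite_cartesian_product finite_lists_length_le finite_PiE) auto
  qed
  have "\<exists>r. \<forall>j. Q r j (r j)"
  proof (rule dependent_wellorder_choice)
    fix n :: nat and r r' :: "nat \<Rightarrow> nat" and j :: nat
    assume eq: "\<And>y. y < j \<Longrightarrow> r y = r' y"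
    then have "arg r j = arg r' j" by (auto simp: arg_def fun_eq_iff)
    then show "Q r j n = Q r' j n"
      using eq[of "j - 1"] by (cases "0 < j") (simp_all add: Q_def swap_ok_def)
  next
    fix j and r :: "nat \<Rightarrow> nat"
    have "\<forall>\<^sub>F n in sequentially. case z of (l, k, is, i, \<sigma>) \<Rightarrow> swap_ok r j n l k is i \<sigma>" for z
    proof -
      obtain l k "is" i \<sigma> where z: "z = (l, k, is, i, \<sigma>)" by (metis prod.exhaust)
      have "(\<lambda>n. \<integral>\<omega>. foldr coord_avg is (\<Phi> l k) ((arg r j \<sigma> \<omega>)(i := X n \<omega>)) (\<mu> \<omega>) \<partial>P)
          \<longlonglongrightarrow> (\<integral>\<omega>. coord_avg i (foldr coord_avg is (\<Phi> l k)) (arg r j \<sigma> \<omega>) (\<mu> \<omega>) \<partial>P)"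
        by (rule swap_tendsto[OF test_fn_foldr_coord_avg[OF test] c(1) \<alpha>(1) S arg_meas])
      from tendstoD[OF this, of "(1 / 2) ^ j"] show ?thesis
        by (simp add: z swap_ok_def dist_real_def)
    qed
    then have "\<forall>\<^sub>F n in sequentially. \<forall>z\<in>swaps j. case z of (l, k, is, i, \<sigma>) \<Rightarrow> swap_ok r j n l k is i \<sigma>"
      using fin_swaps by (intro eventually_ball_finite) auto
    then have "\<forall>\<^sub>F n in sequentially. Q r j n"
      using eventually_gt_at_top[of "r (j - 1)"] unfolding Q_def by eventually_elim auto
    then show "\<exists>n. Q r j n" by (auto simp: eventually_sequentially)
  qed
  then obtain r where r: "\<And>j. Q r j (r j)" by blast
  have "strict_mono r"
    unfolding strict_mono_Suc_iff using r[of "Suc _"] by (simp add: Q_def)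
  moreover have "(\<lambda>k. (\<integral>\<omega>. \<Phi> l k (\<lambda>i. X (r (\<pi> i)) \<omega>) (\<mu> \<omega>) \<partial>P) -
       (\<integral>\<omega>. \<integral>u. \<Phi> l k u (\<mu> \<omega>) \<partial>Pi\<^sub>M UNIV (\<lambda>_. meas (\<mu> \<omega>)) \<partial>P)) \<longlonglongrightarrow> 0"
    if \<pi>: "bij \<pi>" for \<pi> l
  proof (rule Lim_null_comparison)
    define Y where "Y \<omega> = (\<lambda>i. X (r (\<pi> i)) \<omega>)" for \<omega>
    have Y_meas: "(\<lambda>\<omega>. Y \<omega> i) \<in> borel_measurable P" for i unfolding Y_def by simp
    define \<tau> where "\<tau> = inv \<pi>"
    have \<pi>\<tau>: "\<pi> (\<tau> j) = j" "\<tau> (\<pi> i) = i" for i j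
      using \<pi> by (auto simp: \<tau>_def bij_inv_eq_iff surj_f_inv_f bij_is_surj inv_f_f bij_is_inj)
    have "(\<lambda>k. (1 / 2 :: real) ^ N l k) \<longlonglongrightarrow> 0"
      by (rule filterlim_compose[OF LIMSEQ_realpow_zero N]) auto
    then have "(\<lambda>k. real (N l k) * e l k + 2 * (1 / 2) ^ N l k) \<longlonglongrightarrow> 0 + 2 * 0"
      by (intro tendsto_intros Ne)
    then show "(\<lambda>k. real (N l k) * e l k + 2 * (1 / 2) ^ N l k) \<longlonglongrightarrow> 0" by simp
    have "\<forall>\<^sub>F k in sequentially. l \<le> N l k" using N by (simp add: filterlim_at_top)
    then show "\<forall>\<^sub>F k in sequentially. norm ((\<integral>\<omega>. \<Phi> l k (\<lambda>i. X (r (\<pi> i)) \<omega>) (\<mu> \<omega>) \<partial>P) -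
       (\<integral>\<omega>. \<integral>u. \<Phi> l k u (\<mu> \<omega>) \<partial>Pi\<^sub>M UNIV (\<lambda>_. meas (\<mu> \<omega>)) \<partial>P))
        \<le> real (N l k) * e l k + 2 * (1 / 2) ^ N l k"
    proof eventually_elim
      case (elim k)
      have "bdd_above (\<pi> ` I k)" using fin by simp
      then obtain b where "\<And>i. i \<in> I k \<Longrightarrow> \<pi> i \<le> b" unfolding bdd_above_def by blast
      then obtain m where m: "\<And>i. i \<in> I k \<Longrightarrow> \<pi> i < m" by (meson le_imp_less_Suc)
      \<comment> \<open>The positions holding indices at least \<open>j\<close>, in increasing order of these indices, so that lowering \<open>j\<close> by one averages at most one more position, namely \<open>\<tau> j\<close>.\<close>
      define late where "late j = filter (\<lambda>i. i \<in> I k) (map \<tau> [j..<m])" for j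
      have late_set: "set (late j) = {i \<in> I k. j \<le> \<pi> i}" for j
        unfolding late_def using m \<pi>\<tau> by (auto simp: image_iff) (metis atLeastLessThan_iff)
      have late_distinct: "distinct (late j)" for j
      proof -
        have "inj_on \<tau> {j..<m}" by (rule inj_onI) (metis \<pi>\<tau>(1))
        then show ?thesis unfolding late_def by (intro distinct_filter) (simp add: distinct_map)
      qed
      have late_step: "late j = (if \<tau> j \<in> I k then \<tau> j # late (Suc j) else late (Suc j))" if "j < m" for j
        unfolding late_def using that by (simp add: upt_conv_Cons)
      define E where "E j = (\<integral>\<omega>. foldr coord_avg (late j) (\<Phi> l k) (Y \<omega>) (\<mu> \<omega>) \<partial>P)" for j
      have step: "\<bar>E (Suc j) - E j\<bar> \<le> (if j < N l k then e l k else (1 / 2) ^ j)" if "j < m" for j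
      proof (cases "\<tau> j \<in> I k")
        case False
        then show ?thesis using late_step[OF that] e_nonneg by (simp add: E_def)
      next
        case True
        define i where "i = \<tau> j"
        define F where "F = foldr coord_avg (late (Suc j)) (\<Phi> l k)"
        have i: "i \<in> I k" "\<pi> i = j" using True by (simp_all add: i_def \<pi>\<tau>)
        have E: "E (Suc j) = (\<integral>\<omega>. F (Y \<omega>) (\<mu> \<omega>) \<partial>P)"
          "E j = (\<integral>\<omega>. coord_avg i F (Y \<omega>) (\<mu> \<omega>) \<partial>P)"
          using late_step[OF that] True by (simp_all add: E_def F_def i_def)
        have F: "test_fn S (I k - set (late (Suc j))) \<alpha> (c l k) F"
          unfolding F_def by (rule test_fn_foldr_coord_avg[OF test])
        show ?thesis
        proof (cases "j < N l k")
          case True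
          have "\<bar>E (Suc j) - E j\<bar> \<le> mean_cost \<alpha> (c l k) (r j)"
            unfolding E by (rule swap_error[OF F c(1) S Y_meas]) (simp add: Y_def i)
          with e[of l k "r j"] True show ?thesis by simp
        next
          case False
          define \<sigma> where "\<sigma> = (\<lambda>i\<in>I k. min j (\<pi> i))"
          have \<sigma>_arg: "arg r j \<sigma> \<omega> i' = Y \<omega> i'"
            if "i' \<in> I k - set (late (Suc j))" "i' \<noteq> i" for i' \<omega>
          proof -
            have "i' \<in> I k" "\<not> Suc j \<le> \<pi> i'" using that by (auto simp: late_set)
            moreover have "\<pi> i' \<noteq> j" using that(2) \<pi>\<tau>(2)[of i'] by (auto simp: i_def)
            ultimately have "\<sigma> i' = \<pi> i'" "\<pi> i' < j" by (auto simp: \<sigma>_def)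
            then show ?thesis by (simp add: arg_def Y_def)
          qed
          have "length (late (Suc j)) \<le> card (I k)"
            using card_mono[OF fin, of "set (late (Suc j))" k] late_set[of "Suc j"]
              distinct_card[OF late_distinct[of "Suc j"]] by auto
          then have "(l, k, late (Suc j), i, \<sigma>) \<in> swaps j"
            unfolding swaps_def lists_def
            using elim False i late_set[of "Suc j"] by (auto simp: \<sigma>_def)
          then have "swap_ok r j (r j) l k (late (Suc j)) i \<sigma>"
            using r[of j] by (auto simp: Q_def)
          moreover have "F ((arg r j \<sigma> \<omega>)(i := X (r j) \<omega>)) (\<mu> \<omega>) = F (Y \<omega>) (\<mu> \<omega>)" for \<omega>
            using \<sigma>_arg i by (intro test_fn_cong[OF F]) (auto simp: Y_def)
          moreover have "coord_avg i F (arg r j \<sigma> \<omega>) (\<mu> \<omega>) = coord_avg i F (Y \<omega>) (\<mu> \<omega>)" for \<omega>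
            using \<sigma>_arg by (intro test_fn_cong[OF test_fn_coord_avg[OF F]]) auto
          ultimately show ?thesis
            using False unfolding E swap_ok_def F_def by simp
        qed
      qed
      have "\<bar>E m - E 0\<bar> \<le> (\<Sum>j<m. if j < N l k then e l k else (1 / 2) ^ j)"
      proof -
        have "E m - E 0 = (\<Sum>j<m. E (Suc j) - E j)" by (rule sum_lessThan_telescope[symmetric])
        also have "\<bar>\<dots>\<bar> \<le> (\<Sum>j<m. \<bar>E (Suc j) - E j\<bar>)" by (rule sum_abs)
        also have "\<dots> \<le> (\<Sum>j<m. if j < N l k then e l k else (1 / 2) ^ j)"
          using step by (intro sum_mono) simp
        finally show ?thesis .
      qed
      also have "\<dots> \<le> real (N l k) * e l k + 2 * (1 / 2) ^ N l k"
        by (rule sum_two_scale_bound[OF e_nonneg])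
      finally have *: "\<bar>E m - E 0\<bar> \<le> real (N l k) * e l k + 2 * (1 / 2) ^ N l k" .
      have "E m = (\<integral>\<omega>. \<Phi> l k (\<lambda>i. X (r (\<pi> i)) \<omega>) (\<mu> \<omega>) \<partial>P)"
        by (simp add: E_def late_def Y_def)
      moreover have "E 0 = (\<integral>\<omega>. \<integral>u. \<Phi> l k u (\<mu> \<omega>) \<partial>Pi\<^sub>M UNIV (\<lambda>_. meas (\<mu> \<omega>)) \<partial>P)"
        unfolding E_def using late_set[of 0]
        by (subst foldr_coord_avg_all[OF test late_distinct]) auto
      ultimately show ?case using * by simp
    qed
  qed
  ultimately show ?thesis by blast
qed

end

section \<open>The limit theorem\<close>

text \<open>Countably many test functions suffice for weak convergence, since distribution functions are
  squeezed between integrals of steps with rational ends.\<close>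

lemma weak_conv_rational_cts_step:
  assumes M: "\<And>n. real_distribution (M n)" and N: "real_distribution N"
    and conv: "\<And>a b. a \<in> \<rat> \<Longrightarrow> b \<in> \<rat> \<Longrightarrow> a < b \<Longrightarrow>
      (\<lambda>n. \<integral>x. cts_step a b x \<partial>M n) \<longlonglongrightarrow> (\<integral>x. cts_step a b x \<partial>N)"
  shows "weak_conv_m M N"
  unfolding weak_conv_m_def weak_conv_def
proof (intro allI impI)
  fix x assume cont: "isCont (cdf N) x"
  interpret N: real_distribution N by fact
  have mono: "cdf (M n) s \<le> cdf (M n) t" if "s \<le> t" for n s t
    using finite_borel_measure.cdf_nondecreasing[OF real_distribution.finite_borel_measure_M[OF M] that] .
  show "(\<lambda>n. cdf (M n) x) \<longlonglongrightarrow> cdf N x"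
  proof (rule order_tendstoI)
    fix c assume "c < cdf N x"
    then have "\<forall>\<^sub>F y in at x. c < cdf N y"
      using cont by (intro order_tendstoD(1)) (auto simp: isCont_def)
    then obtain d where d: "0 < d" "\<And>y. y \<noteq> x \<Longrightarrow> dist y x < d \<Longrightarrow> c < cdf N y"
      by (auto simp: eventually_at)
    obtain a where a: "a \<in> \<rat>" "x - d < a" "a < x" using Rats_dense_in_real[of "x - d" x] d(1) by auto
    obtain b where b: "b \<in> \<rat>" "a < b" "b < x" using Rats_dense_in_real[OF a(3)] by auto
    have "c < cdf N a" using a by (intro d(2)) (auto simp: dist_real_def)
    also have "\<dots> \<le> (\<integral>x. cts_step a b x \<partial>N)" using b by (intro N.cdf_cts_step)
    finally have "\<forall>\<^sub>F n in sequentially. c < (\<integral>x. cts_step a b x \<partial>M n)"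
      by (rule order_tendstoD(1)[OF conv[OF a(1) b(1,2)]])
    then show "\<forall>\<^sub>F n in sequentially. c < cdf (M n) x"
    proof eventually_elim
      case (elim n)
      also have "(\<integral>x. cts_step a b x \<partial>M n) \<le> cdf (M n) b"
        using b by (intro real_distribution.cdf_cts_step M)
      also have "\<dots> \<le> cdf (M n) x" using b by (intro mono) simp
      finally show ?case .
    qed
  next
    fix c assume "cdf N x < c"
    then have "\<forall>\<^sub>F y in at x. cdf N y < c"
      using cont by (intro order_tendstoD(2)) (auto simp: isCont_def)
    then obtain d where d: "0 < d" "\<And>y. y \<noteq> x \<Longrightarrow> dist y x < d \<Longrightarrow> cdf N y < c"
      by (auto simp: eventually_at)
    obtain b where b: "b \<in> \<rat>" "x < b" "b < x + d" using Rats_dense_in_real[of x "x + d"] d(1) by auto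
    obtain a where a: "a \<in> \<rat>" "x < a" "a < b" using Rats_dense_in_real[OF b(2)] by auto
    have "(\<integral>x. cts_step a b x \<partial>N) \<le> cdf N b" using a by (intro N.cdf_cts_step)
    also have "\<dots> < c" using b by (intro d(2)) (auto simp: dist_real_def)
    finally have "\<forall>\<^sub>F n in sequentially. (\<integral>x. cts_step a b x \<partial>M n) < c"
      by (rule order_tendstoD(2)[OF conv[OF a(1) b(1) a(3)]])
    then show "\<forall>\<^sub>F n in sequentially. cdf (M n) x < c"
    proof eventually_elim
      case (elim n)
      have "cdf (M n) x \<le> cdf (M n) a" using a by (intro mono) simp
      also have "\<dots> \<le> (\<integral>x. cts_step a b x \<partial>M n)"
        using a by (intro real_distribution.cdf_cts_step M)
      finally show ?case using elim by simp
    qed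
  qed
qed

lemma cts_step_range: "a < b \<Longrightarrow> 0 \<le> cts_step a b x \<and> cts_step a b x \<le> 1"
  by (auto simp: cts_step_def field_simps)

lemma cts_step_Lipschitz:
  assumes "a < b"
  shows "\<bar>cts_step a b x - cts_step a b y\<bar> \<le> \<bar>x - y\<bar> / (b - a)"
proof -
  have *: "cts_step a b x = min 1 (max 0 ((b - x) / (b - a)))" for x
    using assms by (auto simp: cts_step_def field_simps min_def max_def)
  have "(b - x) / (b - a) - (b - y) / (b - a) = (y - x) / (b - a)"
    by (simp add: diff_divide_distrib)
  then have "\<bar>(b - x) / (b - a) - (b - y) / (b - a)\<bar> = \<bar>x - y\<bar> / (b - a)"
    using assms by (simp add: abs_divide abs_minus_commute)
  then show ?thesis unfolding * by linarith
qed

lemma cts_step_continuous: "a < b \<Longrightarrow> continuous_on UNIV (cts_step a b)"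
  using cts_step_uniformly_continuous by (rule uniformly_continuous_imp_continuous)

lemma cts_step_measurable [measurable]: "cts_step a b \<in> borel_measurable borel"
  unfolding cts_step_def by measurable

lemma measurable_coord_PiM_meas:
  "(\<lambda>u. u i) \<in> borel_measurable (Pi\<^sub>M (UNIV :: nat set) (\<lambda>_. meas \<nu>))"
  using measurable_component_singleton[of i UNIV "\<lambda>_. meas \<nu>"] by (simp cong: measurable_cong_sets)

lemma coordinate_indep_vars:
  "prob_space.indep_vars (Pi\<^sub>M UNIV (\<lambda>_. meas \<nu>)) (\<lambda>_. borel) (\<lambda>i u. u i) (UNIV :: nat set)"
  "distr (Pi\<^sub>M (UNIV :: nat set) (\<lambda>_. meas \<nu>)) borel (\<lambda>u. u i) = meas \<nu>"
proof -
  let ?N = "Pi\<^sub>M (UNIV :: nat set) (\<lambda>_. meas \<nu>)"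
  interpret prob_space ?N by (intro prob_space_PiM prob_space_meas)
  have distr: "distr ?N borel (\<lambda>u. u i) = meas \<nu>" for i
  proof -
    have "distr ?N borel (\<lambda>u. u i) = distr ?N (meas \<nu>) (\<lambda>u. u i)" by (intro distr_cong) simp_all
    then show ?thesis using distr_PiM_component[of UNIV "\<lambda>_. meas \<nu>" i] prob_space_meas by simp
  qed
  then show "distr ?N borel (\<lambda>u. u i) = meas \<nu>" .
  have "distr ?N (Pi\<^sub>M UNIV (\<lambda>_. borel)) (\<lambda>x. \<lambda>i\<in>UNIV. x i) = ?N"
    unfolding restrict_UNIV by (intro distr_id2 sets_PiM_cong) simp_all
  then show "indep_vars (\<lambda>_. borel) (\<lambda>i u. u i) UNIV"
    by (subst indep_vars_iff_distr_eq_PiM) (simp_all add: distr measurable_coord_PiM_meas)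
qed

text \<open>For \<open>\<nu> = G \<circ> \<mu>\<close>, with \<open>G\<close> constrained on \<open>S\<close> alone, the integrand defining the mixture may fail to
  be measurable on a null set; its nonnegative integral is that of the measurable version \<open>m\<close>.\<close>

lemma mixture_eq_bind:
  assumes "prob_space P" and m: "m \<in> borel_measurable P" and ae: "AE \<omega> in P. \<nu> \<omega> = m \<omega>"
  shows "mixture P \<nu> = P \<bind> (\<lambda>\<omega>. meas (m \<omega>))"
proof -
  interpret prob_space P by fact
  let ?K = "P \<bind> (\<lambda>\<omega>. meas (m \<omega>))"
  have K: "(\<lambda>\<omega>. meas (m \<omega>)) \<in> P \<rightarrow>\<^sub>M subprob_algebra borel"
    using measurable_compose[OF m measurable_meas_subprob] .
  have sets_K: "sets ?K = sets borel" by (rule sets_bind[OF _ not_empty]) simp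
  have "mixture P \<nu> = measure_of UNIV (sets borel) (emeasure ?K)"
    unfolding mixture_def
  proof (rule measure_of_eq)
    fix B assume "B \<in> sigma_sets UNIV (sets (borel :: real measure))"
    then have B: "B \<in> sets borel" using sets.sigma_sets_eq[of "borel :: real measure"] by simp
    have "(\<integral>\<^sup>+\<omega>. emeasure (meas (\<nu> \<omega>)) B \<partial>P) = (\<integral>\<^sup>+\<omega>. emeasure (meas (m \<omega>)) B \<partial>P)"
      using ae by (intro nn_integral_cong_AE) (auto elim!: eventually_mono)
    also have "\<dots> = emeasure ?K B" by (rule emeasure_bind[OF not_empty K B, symmetric])
    finally show "(\<integral>\<^sup>+\<omega>. emeasure (meas (\<nu> \<omega>)) B \<partial>P) = emeasure ?K B" .
  qed auto
  also have "\<dots> = ?K"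
    using measure_of_of_measure[of ?K] sets_K sets_eq_imp_space_eq[OF sets_K] by simp
  finally show ?thesis .
qed

theorem theorem2p2:
  fixes P :: "'a measure"
    and X :: "nat \<Rightarrow> 'a \<Rightarrow> real"
    and \<mu> :: "'a \<Rightarrow> borel_prob"
    and f :: "nat \<Rightarrow> (nat \<Rightarrow> real) \<Rightarrow> borel_prob \<Rightarrow> real"
    and S :: "borel_prob set"
    and G :: "borel_prob \<Rightarrow> borel_prob"
  assumes "prob_space P"
    and "determining P X"
    and "limit_random_measure P X \<mu>"
    and "regular_weak_limit_theorem f S G"
    and "\<P>(\<omega> in P. \<mu> \<omega> \<in> S) = 1"
  shows "\<exists>r :: nat \<Rightarrow> nat. strict_mono r \<and>
    (\<forall>\<pi> :: nat \<Rightarrow> nat. bij \<pi> \<longrightarrow>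
      weak_conv_m (\<lambda>k. distr P borel (\<lambda>\<omega>. f k (\<lambda>i. X (r (\<pi> i)) \<omega>) (\<mu> \<omega>)))
        (mixture P (\<lambda>\<omega>. G (\<mu> \<omega>))))"
proof -
  interpret sc: stable_convergence P X \<mu>
    using assms(1-3) by (rule determining_stable_convergence)
  obtain p q :: "nat \<Rightarrow> nat" and w :: "nat \<Rightarrow> real" and \<alpha> :: real and \<rho> where
    S [measurable]: "S \<in> sets borel"
    and f_cont': "\<forall>k. continuous_on UNIV (\<lambda>(x, \<nu>). f k x \<nu>)"
    and w': "\<forall>k. 0 < w k" "filterlim w at_top sequentially"
    and \<alpha>: "0 < \<alpha>" "\<alpha> \<le> 1"
    and \<rho>: "Metric_space S \<rho>"
    and f_dep': "\<forall>k x x' \<nu>. (\<forall>i\<in>{p k..q k}. x i = x' i) \<longrightarrow> f k x \<nu> = f k x' \<nu>"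
    and f_Hoelder': "\<forall>k x x'. \<forall>\<nu>\<in>S. \<forall>\<nu>'\<in>S.
      \<bar>f k x \<nu> - f k x' \<nu>'\<bar> \<le> 1 / w k * (\<Sum>i=p k..q k. \<bar>x i - x' i\<bar> powr \<alpha>) + \<rho> \<nu> \<nu>'"
    and G: "G \<in> borel_measurable (restrict_space borel S)"
    and iid': "\<forall>\<nu>\<in>S. \<forall>(N :: (nat \<Rightarrow> real) measure) \<xi>. prob_space N \<longrightarrow>
      prob_space.indep_vars N (\<lambda>_. borel) \<xi> UNIV \<longrightarrow> (\<forall>i. distr N borel (\<xi> i) = meas \<nu>) \<longrightarrow>
      weak_conv_m (\<lambda>k. distr N borel (\<lambda>s. f k (\<lambda>i. \<xi> i s) \<nu>)) (meas (G \<nu>))"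
    using assms(4) unfolding regular_weak_limit_theorem_def by (elim conjE exE) (rule that; assumption)
  note f_cont = f_cont'[rule_format] and w = w'(1)[rule_format] w'(2)
    and f_dep = f_dep'[rule_format] and f_Hoelder = f_Hoelder'[rule_format] and iid = iid'[rule_format]
  have in_S: "AE \<omega> in P. \<mu> \<omega> \<in> S"
    using assms(5) by (subst (asm) sc.prob_Collect_eq_1) auto
  have "\<exists>\<omega>\<in>space P. \<mu> \<omega> \<in> S"
  proof (rule ccontr)
    assume "\<not> ?thesis"
    then have "{\<omega> \<in> space P. \<mu> \<omega> \<in> S} = {}" by auto
    with assms(5) show False by simp
  qed
  then obtain \<nu>0 where \<nu>0: "\<nu>0 \<in> S" by blast
  \<comment> \<open>Off a null set \<open>\<mu>\<close> lies in \<open>S\<close>; a version with all its values in \<open>S\<close> has the same averages, so \<open>X\<close> converges stably to it too.\<close>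
  define m where "m \<omega> = (if \<mu> \<omega> \<in> S then \<mu> \<omega> else \<nu>0)" for \<omega>
  have m_S: "m \<omega> \<in> S" for \<omega> using \<nu>0 by (simp add: m_def)
  have m_meas [measurable]: "m \<in> borel_measurable P" unfolding m_def by measurable
  have m_eq: "AE \<omega> in P. \<mu> \<omega> = m \<omega>" using in_S by eventually_elim (simp add: m_def)
  interpret m: stable_convergence P X m
  proof unfold_locales
    fix A and g :: "real \<Rightarrow> real"
    assume A [measurable]: "A \<in> sets P" and g: "continuous_on UNIV g" "\<And>x. \<bar>g x\<bar> \<le> 1"
    have [measurable]: "g \<in> borel_measurable borel"
      using g(1) by (rule borel_measurable_continuous_onI)
    have int_meas [measurable]: "(\<lambda>\<omega>. \<integral>y. g y \<partial>meas (m' \<omega>)) \<in> borel_measurable P"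
      if "m' \<in> borel_measurable P" for m'
      using that by (intro measurable_integral_meas) measurable
    have "(\<integral>\<omega>. indicator A \<omega> * (\<integral>y. g y \<partial>meas (\<mu> \<omega>)) \<partial>P) =
        (\<integral>\<omega>. indicator A \<omega> * (\<integral>y. g y \<partial>meas (m \<omega>)) \<partial>P)"
      by (intro integral_cong_AE borel_measurable_times int_meas) (use m_eq in auto)
    with sc.stable[OF A g]
    show "(\<lambda>n. \<integral>\<omega>. indicator A \<omega> * g (X n \<omega>) \<partial>P)
        \<longlonglongrightarrow> (\<integral>\<omega>. indicator A \<omega> * (\<integral>y. g y \<partial>meas (m \<omega>)) \<partial>P)" by simp
  qed (auto simp: m_meas)
  have f_joint: "(\<lambda>(x, \<nu>). f k x \<nu>) \<in> borel_measurable (seq_borel \<Otimes>\<^sub>M borel)" for k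
    by (rule measurable_Caratheodory_finite_coords[where q="q k"]) (auto intro: f_cont f_dep)
  have f_meas: "(\<lambda>\<omega>. f k (x \<omega>) (m' \<omega>)) \<in> borel_measurable M"
    if "\<And>i. (\<lambda>\<omega>. x \<omega> i) \<in> borel_measurable M" "m' \<in> borel_measurable M" for M :: "'c measure" and k x m'
    using measurable_compose[OF measurable_Pair[OF measurable_to_seq_borel[OF that(1)] that(2)] f_joint]
    by simp
  define R where "R = {(a, b). a \<in> \<rat> \<and> b \<in> \<rat> \<and> a < (b :: real)}"
  have "countable R"
    by (rule countable_subset[of _ "\<rat> \<times> \<rat>"]) (auto simp: R_def countable_rat)
  moreover have "(0, 1) \<in> R" by (simp add: R_def)
  ultimately have R_range: "range (from_nat_into R) = R"
    by (intro range_from_nat_into) auto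
  define a where "a l = fst (from_nat_into R l)" for l
  define b where "b l = snd (from_nat_into R l)" for l
  have ab: "a l < b l" for l
    using range_from_nat_into[of R] R_range rangeI[of "from_nat_into R" l]
    by (auto simp: R_def a_def b_def)
  define \<Phi> where "\<Phi> l k x \<nu> = cts_step (a l) (b l) (f k x \<nu>)" for l k x \<nu>
  \<comment> \<open>Lipschitz constant of the step function times the Hoelder factor of \<open>f k\<close>.\<close>
  define c where "c l k = 1 / (b l - a l) * (1 / w k)" for l k
  have c_nonneg: "0 \<le> c l k" for l k using ab[of l] w(1)[of k] by (simp add: c_def)
  have "(\<lambda>k. 1 / (b l - a l) * (1 / w k)) \<longlonglongrightarrow> 1 / (b l - a l) * 0" for l
    using tendsto_inverse_0_at_top[OF w(2)] by (intro tendsto_intros) (simp add: inverse_eq_divide)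
  then have c_lim: "(\<lambda>k. c l k) \<longlonglongrightarrow> 0" for l by (simp add: c_def)
  have test: "test_fn S {p k..q k} \<alpha> (c l k) (\<Phi> l k)" for l k
    unfolding test_fn_def
  proof (intro conjI allI impI ballI)
    show "(\<lambda>(x, \<nu>). \<Phi> l k x \<nu>) \<in> borel_measurable (seq_borel \<Otimes>\<^sub>M borel)"
      using measurable_compose[OF f_joint cts_step_measurable] by (simp add: \<Phi>_def split_beta)
    show "0 \<le> \<Phi> l k x \<nu>" "\<Phi> l k x \<nu> \<le> 1" for x \<nu>
      using cts_step_range[OF ab] by (auto simp: \<Phi>_def)
    show "\<Phi> l k x \<nu> = \<Phi> l k x' \<nu>" if "\<forall>i\<in>{p k..q k}. x i = x' i" for x x' \<nu>
      unfolding \<Phi>_def using f_dep'[rule_format, of k x x' \<nu>] that by simp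
    fix x :: "nat \<Rightarrow> real" and i :: nat and y y' :: real and \<nu> assume \<nu>: "\<nu> \<in> S"
    have "(\<Sum>j=p k..q k. \<bar>(x(i := y)) j - (x(i := y')) j\<bar> powr \<alpha>)
        = (\<Sum>j=p k..q k. if j = i then \<bar>y - y'\<bar> powr \<alpha> else 0)"
      by (intro sum.cong) auto
    also have "\<dots> \<le> \<bar>y - y'\<bar> powr \<alpha>" by (simp add: sum.delta)
    finally have sum: "(\<Sum>j=p k..q k. \<bar>(x(i := y)) j - (x(i := y')) j\<bar> powr \<alpha>) \<le> \<bar>y - y'\<bar> powr \<alpha>" .
    have "\<rho> \<nu> \<nu> = 0" using Metric_space.mdist_zero[OF \<rho> \<nu>] .
    then have "\<bar>f k (x(i := y)) \<nu> - f k (x(i := y')) \<nu>\<bar> \<le> 1 / w k * \<bar>y - y'\<bar> powr \<alpha>"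
      using order_trans[OF f_Hoelder[OF \<nu> \<nu>, of k "x(i := y)" "x(i := y')"]]
        mult_left_mono[OF sum, of "1 / w k"] w(1)[of k] by simp
    then have "\<bar>f k (x(i := y)) \<nu> - f k (x(i := y')) \<nu>\<bar> / (b l - a l)
        \<le> 1 / w k * \<bar>y - y'\<bar> powr \<alpha> / (b l - a l)"
      using ab[of l] by (intro divide_right_mono) auto
    with cts_step_Lipschitz[OF ab]
    have "\<bar>\<Phi> l k (x(i := y)) \<nu> - \<Phi> l k (x(i := y')) \<nu>\<bar> \<le> 1 / w k * \<bar>y - y'\<bar> powr \<alpha> / (b l - a l)"
      unfolding \<Phi>_def by (rule order_trans)
    then show "\<bar>\<Phi> l k (x(i := y)) \<nu> - \<Phi> l k (x(i := y')) \<nu>\<bar> \<le> c l k * \<bar>y - y'\<bar> powr \<alpha>"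
      by (simp add: c_def mult.commute)
  qed
  have fin: "finite {p k..q k}" for k by simp
  obtain r :: "nat \<Rightarrow> nat" where r: "strict_mono r" and swap: "\<forall>\<pi> l. bij \<pi> \<longrightarrow>
      (\<lambda>k. (\<integral>\<omega>. \<Phi> l k (\<lambda>i. X (r (\<pi> i)) \<omega>) (m \<omega>) \<partial>P) -
       (\<integral>\<omega>. \<integral>u. \<Phi> l k u (m \<omega>) \<partial>Pi\<^sub>M UNIV (\<lambda>_. meas (m \<omega>)) \<partial>P)) \<longlonglongrightarrow> 0"
    using m.swapping_subsequence[where \<Phi>=\<Phi> and c=c and I="\<lambda>k. {p k..q k}",
        OF \<alpha> m_S fin test c_nonneg c_lim] by blast
  have Gm [measurable]: "(\<lambda>\<omega>. G (m \<omega>)) \<in> borel_measurable P"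
  proof -
    have "m \<in> P \<rightarrow>\<^sub>M restrict_space borel S"
      by (intro measurable_restrict_space2 m_meas) (simp add: m_S)
    from measurable_compose[OF this G] show ?thesis .
  qed
  define K where "K = P \<bind> (\<lambda>\<omega>. meas (G (m \<omega>)))"
  have mix: "mixture P (\<lambda>\<omega>. G (\<mu> \<omega>)) = K"
    unfolding K_def
    by (intro mixture_eq_bind assms(1) Gm) (rule eventually_mono[OF m_eq], simp)
  have K_kernel: "(\<lambda>\<omega>. meas (G (m \<omega>))) \<in> P \<rightarrow>\<^sub>M subprob_algebra borel"
    using measurable_compose[OF Gm measurable_meas_subprob] .
  have K: "real_distribution K"
    unfolding K_def real_distribution_def real_distribution_axioms_def
    using K_kernel
    by (auto intro!: sc.prob_space_bind[where S=borel] simp: prob_space_meas sets_bind[OF _ sc.not_empty])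
  have iid_lim: "(\<lambda>k. \<integral>\<omega>. \<integral>u. \<Phi> l k u (m \<omega>) \<partial>Pi\<^sub>M UNIV (\<lambda>_. meas (m \<omega>)) \<partial>P)
      \<longlonglongrightarrow> (\<integral>x. cts_step (a l) (b l) x \<partial>K)" for l
  proof -
    have avg: "(\<integral>u. \<Phi> l k u \<nu> \<partial>Pi\<^sub>M UNIV (\<lambda>_. meas \<nu>)) =
        foldr coord_avg [p k..<Suc (q k)] (\<Phi> l k) (\<lambda>_. 0) \<nu>" for k \<nu>
      by (rule foldr_coord_avg_all[OF test, symmetric]) auto
    note T = test_fn_foldr_coord_avg[OF test[of _ l]]
    have "(\<lambda>k. \<integral>\<omega>. \<integral>u. \<Phi> l k u (m \<omega>) \<partial>Pi\<^sub>M UNIV (\<lambda>_. meas (m \<omega>)) \<partial>P)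
        \<longlonglongrightarrow> (\<integral>\<omega>. \<integral>x. cts_step (a l) (b l) x \<partial>meas (G (m \<omega>)) \<partial>P)"
    proof (rule integral_dominated_convergence[where w="\<lambda>_. 1"])
      show "(\<lambda>\<omega>. \<integral>x. cts_step (a l) (b l) x \<partial>meas (G (m \<omega>))) \<in> borel_measurable P"
        by (intro measurable_integral_meas) measurable
      show "(\<lambda>\<omega>. \<integral>u. \<Phi> l k u (m \<omega>) \<partial>Pi\<^sub>M UNIV (\<lambda>_. meas (m \<omega>))) \<in> borel_measurable P" for k
        unfolding avg by (rule test_fn_measurable[OF T]) auto
      show "AE \<omega> in P. norm (\<integral>u. \<Phi> l k u (m \<omega>) \<partial>Pi\<^sub>M UNIV (\<lambda>_. meas (m \<omega>))) \<le> 1" for k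
        unfolding avg using test_fn_abs[OF T] by (intro AE_I2) simp
      show "AE \<omega> in P. (\<lambda>k. \<integral>u. \<Phi> l k u (m \<omega>) \<partial>Pi\<^sub>M UNIV (\<lambda>_. meas (m \<omega>)))
          \<longlonglongrightarrow> (\<integral>x. cts_step (a l) (b l) x \<partial>meas (G (m \<omega>)))"
      proof (rule AE_I2)
        fix \<omega>
        let ?N = "Pi\<^sub>M (UNIV :: nat set) (\<lambda>_. meas (m \<omega>))"
        have N: "prob_space ?N" by (intro prob_space_PiM prob_space_meas)
        have fN: "(\<lambda>u. f k u (m \<omega>)) \<in> borel_measurable ?N" for k
          by (intro f_meas measurable_coord_PiM_meas) simp
        have "weak_conv_m (\<lambda>k. distr ?N borel (\<lambda>u. f k (\<lambda>i. u i) (m \<omega>))) (meas (G (m \<omega>)))"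
          by (intro iid[OF m_S N coordinate_indep_vars(1)] allI coordinate_indep_vars(2))
        then have "(\<lambda>k. \<integral>x. cts_step (a l) (b l) x \<partial>distr ?N borel (\<lambda>u. f k u (m \<omega>)))
            \<longlonglongrightarrow> (\<integral>x. cts_step (a l) (b l) x \<partial>meas (G (m \<omega>)))"
          using cts_step_continuous[OF ab] cts_step_range[OF ab]
          by (intro weak_conv_imp_integral_bdd_continuous_conv[where B=1]
              prob_space.real_distribution_distr[OF N] real_distribution_meas fN)
            (auto simp: continuous_on_eq_continuous_at)
        then show "(\<lambda>k. \<integral>u. \<Phi> l k u (m \<omega>) \<partial>?N) \<longlonglongrightarrow> (\<integral>x. cts_step (a l) (b l) x \<partial>meas (G (m \<omega>)))"
          by (simp add: integral_distr fN \<Phi>_def)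
      qed
    qed simp
    also have "(\<integral>\<omega>. \<integral>x. cts_step (a l) (b l) x \<partial>meas (G (m \<omega>)) \<partial>P) = (\<integral>x. cts_step (a l) (b l) x \<partial>K)"
      unfolding K_def using cts_step_range[OF ab] K_kernel
      by (intro integral_bind[symmetric, where K=borel and B=1 and B'=1])
        (auto simp: prob_space.emeasure_space_1[OF prob_space_meas, simplified] sc.finite_measure_axioms)
    finally show ?thesis .
  qed
  have "weak_conv_m (\<lambda>k. distr P borel (\<lambda>\<omega>. f k (\<lambda>i. X (r (\<pi> i)) \<omega>) (\<mu> \<omega>)))
        (mixture P (\<lambda>\<omega>. G (\<mu> \<omega>)))" if \<pi>: "bij \<pi>" for \<pi>
    unfolding mix
  proof (rule weak_conv_rational_cts_step[OF _ K])
    have meas_f: "(\<lambda>\<omega>. f k (\<lambda>i. X (r (\<pi> i)) \<omega>) (\<mu> \<omega>)) \<in> borel_measurable P"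
      "(\<lambda>\<omega>. f k (\<lambda>i. X (r (\<pi> i)) \<omega>) (m \<omega>)) \<in> borel_measurable P" for k
      by (intro f_meas; simp)+
    show "real_distribution (distr P borel (\<lambda>\<omega>. f k (\<lambda>i. X (r (\<pi> i)) \<omega>) (\<mu> \<omega>)))" for k
      by (intro sc.real_distribution_distr meas_f)
    fix s t :: real assume "s \<in> \<rat>" "t \<in> \<rat>" "s < t"
    then have "(s, t) \<in> range (from_nat_into R)" unfolding R_range by (simp add: R_def)
    then obtain l where "from_nat_into R l = (s, t)" by (metis rangeE)
    then have l: "a l = s" "b l = t" by (simp_all add: a_def b_def)
    have "(\<integral>x. cts_step s t x \<partial>distr P borel (\<lambda>\<omega>. f k (\<lambda>i. X (r (\<pi> i)) \<omega>) (\<mu> \<omega>)))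
        = (\<integral>\<omega>. \<Phi> l k (\<lambda>i. X (r (\<pi> i)) \<omega>) (m \<omega>) \<partial>P)" for k
    proof -
      have "(\<integral>x. cts_step s t x \<partial>distr P borel (\<lambda>\<omega>. f k (\<lambda>i. X (r (\<pi> i)) \<omega>) (\<mu> \<omega>)))
          = (\<integral>\<omega>. cts_step s t (f k (\<lambda>i. X (r (\<pi> i)) \<omega>) (\<mu> \<omega>)) \<partial>P)"
        by (intro integral_distr meas_f) simp
      also have "\<dots> = (\<integral>\<omega>. cts_step s t (f k (\<lambda>i. X (r (\<pi> i)) \<omega>) (m \<omega>)) \<partial>P)"
        by (intro integral_cong_AE measurable_compose[OF meas_f(1) cts_step_measurable]
            measurable_compose[OF meas_f(2) cts_step_measurable]) (use m_eq in auto)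
      finally show ?thesis by (simp add: \<Phi>_def l)
    qed
    with tendsto_add[OF swap[rule_format, OF \<pi>, of l] iid_lim[of l]]
    show "(\<lambda>k. \<integral>x. cts_step s t x \<partial>distr P borel (\<lambda>\<omega>. f k (\<lambda>i. X (r (\<pi> i)) \<omega>) (\<mu> \<omega>)))
        \<longlonglongrightarrow> (\<integral>x. cts_step s t x \<partial>K)"
      by (simp add: l)
  qed
  with r show ?thesis by blast
qed

end
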